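(* Let $\mathbb F_\infty$ be the free group on countably infinitely many generators $\{g_i\mid i\in\mathbb Z\}$ and $C^*_r(\mathbb F_\infty)$ its reduced group $C^*$-algebra. The canonical tracial state $\tau$ is the unique symmetric state on $C^*_r(\mathbb F_\infty)$.
   Context: $C^*_r(\mathbb F_\infty)$ is the $C^*$-algebra generated by the left regular representation $w\mapsto\lambda_w$ of $\mathbb F_\infty$. The tracial state $\tau$ is determined by $\tau\big(\sum_w a_w\lambda_w\big)=a_{w_\emptyset}$ for finite sums, where $w_\emptyset$ is the empty word (the unit of $\mathbb F_\infty$). The group $\mathbb P_\infty$ of permutations of the index set $\mathbb Z$ moving only finitely many indices acts by automorphisms on $C^*_r(\mathbb F_\infty)$ by permuting the generators, $\lambda_{g_i}\mapsto\lambda_{g_{\sigma(i)}}$, $\sigma\in\mathbb P_\infty$. A state is symmetric if it is invariant under this action. *)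

theory Defs
  imports "HOL-Analysis.Analysis" "HOL-Combinatorics.Perm"
begin

section \<open>Free groups\<close>

text \<open>The letter \<open>(i, True)\<close> stands for the generator with index \<open>i\<close> and
  \<open>(i, False)\<close> for its inverse. A free group element is a reduced word.\<close>

type_synonym 'i letter = "'i \<times> bool"

definition inv_letter :: "'i letter \<Rightarrow> 'i letter"
  where "inv_letter x = (fst x, \<not> snd x)"

fun reduced :: "'i letter list \<Rightarrow> bool" where
  "reduced [] \<longleftrightarrow> True"
| "reduced [x] \<longleftrightarrow> True"
| "reduced (x # y # ys) \<longleftrightarrow> y \<noteq> inv_letter x \<and> reduced (y # ys)"

fun push :: "'i letter \<Rightarrow> 'i letter list \<Rightarrow> 'i letter list" where
  "push x [] = [x]"
| "push x (y # ys) = (if y = inv_letter x then ys else x # y # ys)"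

definition rmult :: "'i letter list \<Rightarrow> 'i letter list \<Rightarrow> 'i letter list"
  where "rmult u v = foldr push u v"

definition rinv :: "'i letter list \<Rightarrow> 'i letter list"
  where "rinv u = rev (map inv_letter u)"

lemma inv_letter_inv_letter [simp]: "inv_letter (inv_letter x) = x"
  by (cases x) (simp add: inv_letter_def)

lemma reduced_ConsD: "reduced (x # xs) \<Longrightarrow> reduced xs"
  by (cases xs) auto

lemma reduced_push: "reduced xs \<Longrightarrow> reduced (push x xs)"
  by (cases xs) (auto dest: reduced_ConsD)

lemma reduced_rmult: "reduced v \<Longrightarrow> reduced (rmult u v)"
  unfolding rmult_def by (induction u) (auto intro: reduced_push)

lemma push_inv_push: "reduced v \<Longrightarrow> push (inv_letter x) (push x v) = v"
proof (induction v)
  case (Cons y ys)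
  then show ?case by (cases ys) auto
qed simp

lemma push_push_inv: "reduced v \<Longrightarrow> push x (push (inv_letter x) v) = v"
  using push_inv_push[of v "inv_letter x"] by simp

lemma rmult_push: "reduced u \<Longrightarrow> reduced v \<Longrightarrow> rmult (push x u) v = push x (rmult u v)"
  by (cases u) (auto simp: rmult_def push_push_inv reduced_rmult[unfolded rmult_def])

lemma rmult_assoc:
  assumes "reduced v" "reduced w"
  shows "rmult (rmult u v) w = rmult u (rmult v w)"
proof (induction u)
  case (Cons x u)
  have "rmult (rmult (x # u) v) w = rmult (push x (rmult u v)) w"
    by (simp add: rmult_def)
  also have "\<dots> = push x (rmult (rmult u v) w)"
    using assms by (simp add: rmult_push reduced_rmult)
  finally show ?case using Cons by (simp add: rmult_def)
qed (simp add: rmult_def)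

lemma rmult_Nil_right: "reduced u \<Longrightarrow> rmult u [] = u"
proof (induction u)
  case (Cons x u)
  then show ?case by (cases u) (auto simp: rmult_def)
qed (simp add: rmult_def)

lemma reduced_snoc:
  "reduced (xs @ [y, z]) \<longleftrightarrow> reduced (xs @ [y]) \<and> z \<noteq> inv_letter y"
proof (induction xs)
  case (Cons x xs)
  then show ?case by (cases xs) auto
qed auto

lemma reduced_rinv: "reduced u \<Longrightarrow> reduced (rinv u)"
proof (induction u)
  case (Cons x u)
  then show ?case by (cases u) (auto simp: rinv_def reduced_snoc)
qed (simp add: rinv_def)

lemma rmult_rinv_left: "reduced v \<Longrightarrow> rmult (rinv u) (rmult u v) = v"
proof (induction u)
  case (Cons x u)
  have "rmult (rinv (x # u)) (rmult (x # u) v)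
      = rmult (rinv u) (push (inv_letter x) (push x (rmult u v)))"
    by (simp add: rmult_def rinv_def)
  then show ?case using Cons by (simp add: push_inv_push reduced_rmult)
qed (simp add: rmult_def rinv_def)

typedef 'i free_group = "{w :: 'i letter list. reduced w}"
  morphisms letters Free_group
  by (rule exI[of _ "[]"]) simp

setup_lifting type_definition_free_group

instantiation free_group :: (type) "{monoid_mult, inverse}"
begin

lift_definition one_free_group :: "'a free_group" is "[]" by simp

lift_definition times_free_group :: "'a free_group \<Rightarrow> 'a free_group \<Rightarrow> 'a free_group"
  is rmult by (rule reduced_rmult)

lift_definition inverse_free_group :: "'a free_group \<Rightarrow> 'a free_group"
  is rinv by (rule reduced_rinv)

definition divide_free_group :: "'a free_group \<Rightarrow> 'a free_group \<Rightarrow> 'a free_group"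
  where "divide_free_group u v = u * inverse v"

instance
proof
  fix a b c :: "'a free_group"
  show "a * b * c = a * (b * c)" by transfer (rule rmult_assoc)
  show "1 * a = a" by transfer (simp add: rmult_def)
  show "a * 1 = a" by transfer (rule rmult_Nil_right)
qed

end

lemma free_group_left_inverse: "inverse w * w = (1 :: 'i free_group)"
proof transfer
  fix w :: "'i letter list" assume "reduced w"
  then show "rmult (rinv w) w = []"
    using rmult_rinv_left[of "[]" w] by (simp add: rmult_Nil_right)
qed

lemma free_group_right_inverse: "w * inverse w = (1 :: 'i free_group)"
  by (metis free_group_left_inverse mult.assoc mult_1)

lift_definition free_gen :: "'i \<Rightarrow> 'i free_group" is "\<lambda>i. [(i, True)]" by simp


section \<open>The Hilbert space of square-summable functions\<close>

lemma square_summable_add: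
  fixes f g :: "'a \<Rightarrow> complex"
  assumes "(\<lambda>x. (cmod (f x))\<^sup>2) summable_on UNIV" "(\<lambda>x. (cmod (g x))\<^sup>2) summable_on UNIV"
  shows "(\<lambda>x. (cmod (f x + g x))\<^sup>2) summable_on UNIV"
proof (rule summable_on_comparison_test)
  show "(\<lambda>x. 2 * (cmod (f x))\<^sup>2 + 2 * (cmod (g x))\<^sup>2) summable_on UNIV"
    by (intro summable_on_add summable_on_cmult_right assms)
  fix x
  have "(cmod (f x + g x))\<^sup>2 \<le> (cmod (f x) + cmod (g x))\<^sup>2"
    by (intro power_mono norm_triangle_ineq) simp
  also have "\<dots> \<le> 2 * (cmod (f x))\<^sup>2 + 2 * (cmod (g x))\<^sup>2"
    using sum_squares_bound[of "cmod (f x)" "cmod (g x)"] by (simp add: power2_sum)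
  finally show "(cmod (f x + g x))\<^sup>2 \<le> 2 * (cmod (f x))\<^sup>2 + 2 * (cmod (g x))\<^sup>2" .
qed simp

lemma square_summable_cmult:
  fixes f :: "'a \<Rightarrow> complex"
  assumes "(\<lambda>x. (cmod (f x))\<^sup>2) summable_on UNIV"
  shows "(\<lambda>x. (cmod (c * f x))\<^sup>2) summable_on UNIV"
  using summable_on_cmult_right[OF assms, of "(cmod c)\<^sup>2"]
  by (simp add: norm_mult power_mult_distrib)

lemma square_summable_product:
  fixes f g :: "'a \<Rightarrow> complex"
  assumes "(\<lambda>x. (cmod (f x))\<^sup>2) summable_on UNIV" "(\<lambda>x. (cmod (g x))\<^sup>2) summable_on UNIV"
  shows "(\<lambda>x. cmod (f x) * cmod (g x)) summable_on UNIV"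
proof (rule summable_on_comparison_test)
  show "(\<lambda>x. (cmod (f x))\<^sup>2 + (cmod (g x))\<^sup>2) summable_on UNIV"
    by (intro summable_on_add assms)
  fix x
  have "0 \<le> cmod (f x) * cmod (g x)" by simp
  then show "cmod (f x) * cmod (g x) \<le> (cmod (f x))\<^sup>2 + (cmod (g x))\<^sup>2"
    using sum_squares_bound[of "cmod (f x)" "cmod (g x)"] by linarith
qed simp

typedef 'a ell2 = "{f :: 'a \<Rightarrow> complex. (\<lambda>x. (cmod (f x))\<^sup>2) summable_on UNIV}"
  morphisms ell2_apply Ell2
  by (rule exI[of _ "\<lambda>_. 0"]) simp

setup_lifting type_definition_ell2

lemma ell2_eqI: "(\<And>x. ell2_apply f x = ell2_apply g x) \<Longrightarrow> f = g"
  by (metis ell2_apply_inject ext)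

lift_definition scaleC :: "complex \<Rightarrow> 'a ell2 \<Rightarrow> 'a ell2" (infixr \<open>*\<^sub>C\<close> 75)
  is "\<lambda>c f x. c * f x"
  by (rule square_summable_cmult)

instantiation ell2 :: (type) real_vector
begin

lift_definition zero_ell2 :: "'a ell2" is "\<lambda>_. 0" by simp

lift_definition plus_ell2 :: "'a ell2 \<Rightarrow> 'a ell2 \<Rightarrow> 'a ell2" is "\<lambda>f g x. f x + g x"
  by (rule square_summable_add)

lift_definition uminus_ell2 :: "'a ell2 \<Rightarrow> 'a ell2" is "\<lambda>f x. - f x" by simp

lift_definition minus_ell2 :: "'a ell2 \<Rightarrow> 'a ell2 \<Rightarrow> 'a ell2" is "\<lambda>f g x. f x - g x"
proof -
  fix f g :: "'a \<Rightarrow> complex"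
  assume "(\<lambda>x. (cmod (f x))\<^sup>2) summable_on UNIV" "(\<lambda>x. (cmod (g x))\<^sup>2) summable_on UNIV"
  then show "(\<lambda>x. (cmod (f x - g x))\<^sup>2) summable_on UNIV"
    using square_summable_add[of f "\<lambda>x. - g x"] by simp
qed

lift_definition scaleR_ell2 :: "real \<Rightarrow> 'a ell2 \<Rightarrow> 'a ell2" is "\<lambda>r f x. of_real r * f x"
  by (rule square_summable_cmult)

instance
proof
  fix f g h :: "'a ell2" and r s :: real
  show "f + g + h = f + (g + h)" by transfer (simp add: add.assoc)
  show "f + g = g + f" by transfer (simp add: add.commute)
  show "0 + f = f" by transfer simp
  show "- f + f = 0" by transfer simp
  show "f - g = f + - g" by transfer simp
  show "r *\<^sub>R (f + g) = r *\<^sub>R f + r *\<^sub>R g" by transfer (simp add: algebra_simps)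
  show "(r + s) *\<^sub>R f = r *\<^sub>R f + s *\<^sub>R f" by transfer (simp add: algebra_simps)
  show "r *\<^sub>R s *\<^sub>R f = (r * s) *\<^sub>R f" by transfer (simp add: algebra_simps)
  show "1 *\<^sub>R f = f" by transfer simp
qed

end

text \<open>The type class library has only real inner products; \<open>f \<bullet> g\<close> is the real part of
  the complex inner product, which gives the same norm.\<close>

instantiation ell2 :: (type) real_inner
begin

lift_definition inner_ell2 :: "'a ell2 \<Rightarrow> 'a ell2 \<Rightarrow> real"
  is "\<lambda>f g. \<Sum>\<^sub>\<infinity>x. f x \<bullet> g x" .

definition norm_ell2 :: "'a ell2 \<Rightarrow> real" where "norm_ell2 f = sqrt (f \<bullet> f)"
definition sgn_ell2 :: "'a ell2 \<Rightarrow> 'a ell2" where "sgn_ell2 f = f /\<^sub>R norm f"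
definition dist_ell2 :: "'a ell2 \<Rightarrow> 'a ell2 \<Rightarrow> real" where "dist_ell2 f g = norm (f - g)"
definition uniformity_ell2 :: "('a ell2 \<times> 'a ell2) filter"
  where "uniformity_ell2 = (INF e\<in>{0<..}. principal {(f, g). dist f g < e})"
definition open_ell2 :: "'a ell2 set \<Rightarrow> bool"
  where "open_ell2 U \<longleftrightarrow> (\<forall>f\<in>U. eventually (\<lambda>(f', g). f' = f \<longrightarrow> g \<in> U) uniformity)"

instance
proof
  fix f g h :: "'a ell2" and r :: real
  show "dist f g = norm (f - g)" by (simp add: dist_ell2_def)
  show "sgn f = f /\<^sub>R norm f" by (simp add: sgn_ell2_def)
  show "uniformity = (INF e\<in>{0<..}. principal {(f :: 'a ell2, g). dist f g < e})"
    by (simp add: uniformity_ell2_def)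
  show "open U \<longleftrightarrow> (\<forall>f\<in>U. eventually (\<lambda>(f', g). f' = f \<longrightarrow> g \<in> U) uniformity)"
    for U :: "'a ell2 set" by (simp add: open_ell2_def)
  show "norm f = sqrt (f \<bullet> f)" by (simp add: norm_ell2_def)
  have inner_summable: "(\<lambda>x. p x \<bullet> q x) summable_on UNIV"
    if "(\<lambda>x. (cmod (p x))\<^sup>2) summable_on UNIV" "(\<lambda>x. (cmod (q x))\<^sup>2) summable_on UNIV"
    for p q :: "'a \<Rightarrow> complex"
  proof -
    have "(\<lambda>x. norm (p x \<bullet> q x)) summable_on UNIV"
    proof (rule summable_on_comparison_test)
      show "(\<lambda>x. cmod (p x) * cmod (q x)) summable_on UNIV"
        using that by (rule square_summable_product)
      show "norm (p x \<bullet> q x) \<le> cmod (p x) * cmod (q x)" for x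
        using Cauchy_Schwarz_ineq2[of "p x" "q x"] by simp
    qed simp
    then show ?thesis by (rule summable_on_iff_abs_summable_on_real[THEN iffD2])
  qed
  show "f \<bullet> g = g \<bullet> f" by transfer (simp add: inner_commute)
  show "(f + g) \<bullet> h = f \<bullet> h + g \<bullet> h"
    by transfer (simp add: inner_add_left infsum_add inner_summable)
  show "(r *\<^sub>R f) \<bullet> g = r * (f \<bullet> g)"
  proof transfer
    fix r :: real and p q :: "'a \<Rightarrow> complex"
    have "(of_real r * p x) \<bullet> q x = r * (p x \<bullet> q x)" for x
      by (metis inner_scaleR_left scaleR_conv_of_real)
    then show "(\<Sum>\<^sub>\<infinity>x. (of_real r * p x) \<bullet> q x) = r * (\<Sum>\<^sub>\<infinity>x. p x \<bullet> q x)"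
      by (simp add: infsum_cmult_right')
  qed
  show "0 \<le> f \<bullet> f" by transfer (simp add: infsum_nonneg)
  show "f \<bullet> f = 0 \<longleftrightarrow> f = 0"
  proof transfer
    fix p :: "'a \<Rightarrow> complex"
    assume p: "(\<lambda>x. (cmod (p x))\<^sup>2) summable_on UNIV"
    show "(\<Sum>\<^sub>\<infinity>x. p x \<bullet> p x) = 0 \<longleftrightarrow> p = (\<lambda>_. 0)"
    proof
      assume eq: "(\<Sum>\<^sub>\<infinity>x. p x \<bullet> p x) = 0"
      have "p x \<bullet> p x = 0" for x
        by (rule nonneg_infsum_le_0D[where A = UNIV and f = "\<lambda>x. p x \<bullet> p x"])
           (use eq in \<open>auto intro: inner_summable[OF p p]\<close>)
      then show "p = (\<lambda>_. 0)" by auto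
    qed simp
  qed
qed

end

text \<open>Linear in the first argument.\<close>

lift_definition cinner :: "'a ell2 \<Rightarrow> 'a ell2 \<Rightarrow> complex"
  is "\<lambda>f g. \<Sum>\<^sub>\<infinity>x. f x * cnj (g x)" .

lemma norm_ell2_eq: "norm f = sqrt (\<Sum>\<^sub>\<infinity>x. (cmod (ell2_apply f x))\<^sup>2)"
  by (simp add: norm_ell2_def inner_ell2.rep_eq power2_norm_eq_inner)

lemma norm_scaleC: "norm (c *\<^sub>C f) = cmod c * norm f"
  by (simp add: norm_ell2_eq scaleC.rep_eq norm_mult power_mult_distrib infsum_cmult_right'
      real_sqrt_mult)


section \<open>Operators and C*-algebras of operators\<close>

text \<open>The library's bounded operators between real normed spaces are only real linear;
  \<open>cbounded\<close> singles out the complex linear ones.\<close>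

type_synonym 'a operator = "'a ell2 \<Rightarrow>\<^sub>L 'a ell2"

definition cbounded :: "'a operator set"
  where "cbounded = {T. \<forall>c f. blinfun_apply T (c *\<^sub>C f) = c *\<^sub>C blinfun_apply T f}"

definition op_scaleC :: "complex \<Rightarrow> 'a operator \<Rightarrow> 'a operator" (infixr \<open>*\<^sub>O\<close> 75)
  where "c *\<^sub>O T = Blinfun (\<lambda>f. c *\<^sub>C blinfun_apply T f)"

lemma blinfun_apply_op_scaleC: "blinfun_apply (c *\<^sub>O T) f = c *\<^sub>C blinfun_apply T f"
proof -
  have "bounded_linear (\<lambda>f. c *\<^sub>C blinfun_apply T f)"
  proof (rule bounded_linear_intro)
    fix f g :: "'a ell2" and r :: real
    show "c *\<^sub>C blinfun_apply T (f + g) = c *\<^sub>C blinfun_apply T f + c *\<^sub>C blinfun_apply T g"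
      by (rule ell2_eqI)
         (simp add: blinfun.add_right scaleC.rep_eq plus_ell2.rep_eq algebra_simps)
    show "c *\<^sub>C blinfun_apply T (r *\<^sub>R f) = r *\<^sub>R c *\<^sub>C blinfun_apply T f"
      by (rule ell2_eqI)
         (simp add: blinfun.scaleR_right scaleC.rep_eq scaleR_ell2.rep_eq algebra_simps)
    show "norm (c *\<^sub>C blinfun_apply T f) \<le> norm f * (cmod c * norm T)"
      using mult_left_mono[OF norm_blinfun[of T f], of "cmod c"]
      by (simp add: norm_scaleC algebra_simps)
  qed
  from bounded_linear_Blinfun_apply[OF this] show ?thesis
    unfolding op_scaleC_def by (rule fun_cong)
qed

text \<open>For complex linear \<open>T\<close> this is the Hilbert space adjoint.\<close>

definition op_adj :: "'a operator \<Rightarrow> 'a operator"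
  where "op_adj T = (THE S. \<forall>f g. cinner (blinfun_apply T f) g = cinner f (blinfun_apply S g))"

definition cstar_subalgebra :: "'a operator set \<Rightarrow> bool" where
  "cstar_subalgebra A \<longleftrightarrow>
     A \<subseteq> cbounded \<and> closed A \<and> 0 \<in> A \<and>
     (\<forall>S\<in>A. \<forall>T\<in>A. S + T \<in> A \<and> S o\<^sub>L T \<in> A) \<and>
     (\<forall>c. \<forall>T\<in>A. c *\<^sub>O T \<in> A) \<and>
     (\<forall>T\<in>A. op_adj T \<in> A)"

definition cstar_generated :: "'a operator set \<Rightarrow> 'a operator set"
  where "cstar_generated X = \<Inter> {A. cstar_subalgebra A \<and> X \<subseteq> A}"

definition cstar_automorphism :: "'a operator set \<Rightarrow> ('a operator \<Rightarrow> 'a operator) \<Rightarrow> bool" where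
  "cstar_automorphism A \<alpha> \<longleftrightarrow>
     bij_betw \<alpha> A A \<and>
     (\<forall>S\<in>A. \<forall>T\<in>A. \<alpha> (S + T) = \<alpha> S + \<alpha> T \<and> \<alpha> (S o\<^sub>L T) = \<alpha> S o\<^sub>L \<alpha> T) \<and>
     (\<forall>c. \<forall>T\<in>A. \<alpha> (c *\<^sub>O T) = c *\<^sub>O \<alpha> T) \<and>
     (\<forall>T\<in>A. \<alpha> (op_adj T) = op_adj (\<alpha> T))"

text \<open>States on a C*-algebra containing the identity operator. Only the values of \<open>\<phi>\<close> on
  \<open>A\<close> matter.\<close>

definition state_on :: "'a operator set \<Rightarrow> ('a operator \<Rightarrow> complex) \<Rightarrow> bool" where
  "state_on A \<phi> \<longleftrightarrow>
     (\<forall>S\<in>A. \<forall>T\<in>A. \<phi> (S + T) = \<phi> S + \<phi> T) \<and>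
     (\<forall>c. \<forall>T\<in>A. \<phi> (c *\<^sub>O T) = c * \<phi> T) \<and>
     (\<forall>T\<in>A. \<phi> (op_adj T o\<^sub>L T) \<in> \<real>\<^sub>\<ge>\<^sub>0) \<and>
     \<phi> id_blinfun = 1"

definition tracial_on :: "'a operator set \<Rightarrow> ('a operator \<Rightarrow> complex) \<Rightarrow> bool"
  where "tracial_on A \<phi> \<longleftrightarrow> (\<forall>S\<in>A. \<forall>T\<in>A. \<phi> (S o\<^sub>L T) = \<phi> (T o\<^sub>L S))"


section \<open>The reduced C*-algebra of a free group\<close>

lemma bij_left_translation: "bij (\<lambda>v. inverse w * v :: 'i free_group)"
  by (rule bij_betw_byWitness[where f' = "\<lambda>v. w * v"])
     (auto simp: mult.assoc[symmetric] free_group_left_inverse free_group_right_inverse)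

definition translate :: "'i free_group \<Rightarrow> 'i free_group ell2 \<Rightarrow> 'i free_group ell2"
  where "translate w f = Ell2 (\<lambda>v. ell2_apply f (inverse w * v))"

lemma ell2_apply_translate: "ell2_apply (translate w f) v = ell2_apply f (inverse w * v)"
proof -
  have "(\<lambda>v. (cmod (ell2_apply f v))\<^sup>2) summable_on UNIV"
    using ell2_apply[of f] by simp
  then have "(\<lambda>v. (cmod (ell2_apply f (inverse w * v)))\<^sup>2) summable_on UNIV"
    by (rule summable_on_reindex_bij_betw[OF bij_left_translation, THEN iffD2])
  then have "ell2_apply (translate w f) = (\<lambda>v. ell2_apply f (inverse w * v))"
    unfolding translate_def by (intro Ell2_inverse) blast
  then show ?thesis by (rule fun_cong)
qed

lemma norm_translate: "norm (translate w f) = norm f"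
proof -
  have "(\<Sum>\<^sub>\<infinity>v. (cmod (ell2_apply f (inverse w * v)))\<^sup>2) = (\<Sum>\<^sub>\<infinity>v. (cmod (ell2_apply f v))\<^sup>2)"
    by (rule infsum_reindex_bij_betw[OF bij_left_translation])
  then show ?thesis
    unfolding norm_ell2_eq ell2_apply_translate by (rule arg_cong)
qed

lemma bounded_linear_translate: "bounded_linear (translate (w :: 'i free_group))"
proof (rule bounded_linear_intro)
  fix f g :: "'i free_group ell2" and r :: real
  show "translate w (f + g) = translate w f + translate w g"
    by (rule ell2_eqI) (simp add: ell2_apply_translate plus_ell2.rep_eq)
  show "translate w (r *\<^sub>R f) = r *\<^sub>R translate w f"
    by (rule ell2_eqI) (simp add: ell2_apply_translate scaleR_ell2.rep_eq)
  show "norm (translate w f) \<le> norm f * 1" by (simp add: norm_translate)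
qed

text \<open>The left regular representation \<open>w \<mapsto> \<lambda>\<^sub>w\<close>.\<close>

definition lreg :: "'i free_group \<Rightarrow> 'i free_group operator"
  where "lreg w = Blinfun (translate w)"

lemma blinfun_apply_lreg: "blinfun_apply (lreg w) = translate w"
  unfolding lreg_def by (rule bounded_linear_Blinfun_apply[OF bounded_linear_translate])

definition reduced_cstar :: "'i free_group operator set"
  where "reduced_cstar = cstar_generated (range lreg)"

text \<open>The following two descriptions are unique because states and *-automorphisms are norm
  continuous and the span of the operators \<open>\<lambda>\<^sub>w\<close> is dense; \<open>extensional\<close> fixes the irrelevant
  values outside \<open>reduced_cstar\<close>. The automorphism exists because it is implemented by the
  unitary that permutes the generators inside each word.\<close>

definition canonical_trace :: "'i free_group operator \<Rightarrow> complex" where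
  "canonical_trace = (THE \<tau>.
     \<tau> \<in> extensional reduced_cstar \<and> state_on reduced_cstar \<tau> \<and> tracial_on reduced_cstar \<tau> \<and>
     (\<forall>W a. finite W \<longrightarrow> \<tau> (\<Sum>w\<in>W. a w *\<^sub>O lreg w) = (if 1 \<in> W then a 1 else 0)))"

text \<open>The type \<^typ>\<open>'i perm\<close> consists of the permutations moving only finitely many points.\<close>

definition perm_action :: "'i perm \<Rightarrow> 'i free_group operator \<Rightarrow> 'i free_group operator" where
  "perm_action \<sigma> = (THE \<alpha>.
     \<alpha> \<in> extensional reduced_cstar \<and> cstar_automorphism reduced_cstar \<alpha> \<and>
     (\<forall>i. \<alpha> (lreg (free_gen i)) = lreg (free_gen (Perm.apply \<sigma> i))))"

definition symmetric_state :: "('i free_group operator \<Rightarrow> complex) \<Rightarrow> bool" where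
  "symmetric_state \<phi> \<longleftrightarrow>
     state_on reduced_cstar \<phi> \<and> (\<forall>\<sigma>. \<forall>T\<in>reduced_cstar. \<phi> (perm_action \<sigma> T) = \<phi> T)"

end

theory Submission
  imports Defs
begin

text \<open>
  The trace is the vector state of the point mass at the unit of the free group. Renaming the
  generators is implemented by a unitary that fixes this vector, so the trace is symmetric.

  Uniqueness comes from averaging. Let \<open>\<phi>\<close> be a symmetric state and \<open>w\<close> a nonempty reduced word.
  Finite permutations \<open>\<sigma>\<^sub>1, \<dots>, \<sigma>\<^sub>N\<close> can move the generators occurring in \<open>w\<close> to pairwise disjoint
  sets, and by symmetry \<open>N \<phi>(\<lambda>\<^sub>w)\<close> is the value of \<open>\<phi>\<close> at the sum of the translations by the renamed
  words. The norm of that sum is at most \<open>2\<surd>N\<close> (lemma \<open>norm_sum_lreg_le\<close>), while a state is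
  norm bounded, so dividing by \<open>N\<close> forces \<open>\<phi>(\<lambda>\<^sub>w) = 0\<close> (lemma \<open>symmetric_state_lreg\<close>). Hence \<open>\<phi>\<close>
  agrees with the trace on every \<open>\<lambda>\<^sub>w\<close>, and by density everywhere.

  The norm estimate is a ping-pong argument. Let \<open>E\<^sub>j\<close> be the set of words whose first letter lies in
  the \<open>j\<close>-th alphabet. Translation by the \<open>j\<close>-th word maps the complement of \<open>E\<^sub>j\<close> into \<open>E\<^sub>j\<close>. On the
  functions vanishing on \<open>E\<^sub>j\<close> the translations therefore have orthogonal images, and on the pieces
  supported in the disjoint sets \<open>E\<^sub>j\<close> the Cauchy-Schwarz inequality applies; each part
  contributes \<open>\<surd>N\<close>.

  States and *-automorphisms are given by algebraic axioms only, so their continuity has to be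
  derived from positivity: for self-adjoint \<open>H\<close> in the algebra with \<open>\<parallel>H\<parallel> < 1\<close> the element \<open>1 - H\<close> is the
  square of a self-adjoint element of the algebra (lemma \<open>exists_sqrt_one_minus\<close>). The root is found
  by Banach's fixed point theorem, hence the completeness of \<open>\<ell>\<^sup>2\<close>. Continuity
  together with the description of the algebra as the closed span of the translations also makes
  the trace and the permutation action the unique objects with their defining properties.
\<close>


section \<open>Completeness and the complex inner product\<close>

lemma ell2_square_summable: "(\<lambda>x. (cmod (ell2_apply f x))\<^sup>2) summable_on A"
  using ell2_apply[of f] summable_on_subset_banach[of _ UNIV A] by auto

lemma sum_squares_le_norm:
  assumes "finite F"
  shows "(\<Sum>x\<in>F. (cmod (ell2_apply f x))\<^sup>2) \<le> (norm f)\<^sup>2"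
proof -
  have "(\<Sum>x\<in>F. (cmod (ell2_apply f x))\<^sup>2) \<le> (\<Sum>\<^sub>\<infinity>x. (cmod (ell2_apply f x))\<^sup>2)"
    by (rule finite_sum_le_infsum) (use assms ell2_square_summable in auto)
  also have "\<dots> = (norm f)\<^sup>2"
    by (simp add: norm_ell2_eq infsum_nonneg)
  finally show ?thesis .
qed

lemma norm_ell2_apply_le: "cmod (ell2_apply f x) \<le> norm f"
  by (rule power2_le_imp_le) (use sum_squares_le_norm[of "{x}" f] in auto)

lemma norm_ell2_le:
  assumes "\<And>F. finite F \<Longrightarrow> (\<Sum>x\<in>F. (cmod (ell2_apply f x))\<^sup>2) \<le> b\<^sup>2" "0 \<le> b"
  shows "norm f \<le> b"
proof -
  have "(\<Sum>\<^sub>\<infinity>x. (cmod (ell2_apply f x))\<^sup>2) \<le> b\<^sup>2"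
    by (rule infsum_le_finite_sums) (use assms ell2_square_summable in auto)
  then have "norm f \<le> sqrt (b\<^sup>2)"
    unfolding norm_ell2_eq by (rule real_sqrt_le_mono)
  with \<open>0 \<le> b\<close> show ?thesis by simp
qed

instance ell2 :: (type) banach
proof
  fix X :: "nat \<Rightarrow> 'a ell2"
  assume "Cauchy X"
  have "Cauchy (\<lambda>n. ell2_apply (X n) x)" for x
  proof (rule metric_CauchyI)
    fix e :: real assume "0 < e"
    then obtain M where M: "\<forall>m\<ge>M. \<forall>n\<ge>M. norm (X m - X n) < e"
      using \<open>Cauchy X\<close> by (auto simp: Cauchy_def dist_norm)
    have "dist (ell2_apply (X m) x) (ell2_apply (X n) x) < e" if "m \<ge> M" "n \<ge> M" for m n
      using M that norm_ell2_apply_le[of "X m - X n" x]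
      by (fastforce simp: dist_norm minus_ell2.rep_eq)
    then show "\<exists>M. \<forall>m\<ge>M. \<forall>n\<ge>M. dist (ell2_apply (X m) x) (ell2_apply (X n) x) < e" by blast
  qed
  then have "\<forall>x. \<exists>l. (\<lambda>n. ell2_apply (X n) x) \<longlonglongrightarrow> l"
    using Cauchy_convergent convergent_def by blast
  then obtain L where L: "\<And>x. (\<lambda>n. ell2_apply (X n) x) \<longlonglongrightarrow> L x" by metis
  \<comment> \<open>Fatou's argument: a bound on finite partial sums of \<open>X m - X n\<close> survives the pointwise
      limit in \<open>n\<close>.\<close>
  have tail: "\<exists>M. \<forall>m\<ge>M. \<forall>F. finite F \<longrightarrow> (\<Sum>x\<in>F. (cmod (ell2_apply (X m) x - L x))\<^sup>2) \<le> e\<^sup>2"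
    if "0 < e" for e
  proof -
    obtain M where M: "\<forall>m\<ge>M. \<forall>n\<ge>M. norm (X m - X n) < e"
      using \<open>Cauchy X\<close> \<open>0 < e\<close> by (auto simp: Cauchy_def dist_norm)
    have "(\<Sum>x\<in>F. (cmod (ell2_apply (X m) x - L x))\<^sup>2) \<le> e\<^sup>2" if "m \<ge> M" "finite F" for m F
    proof (rule LIMSEQ_le_const2)
      show "(\<lambda>n. \<Sum>x\<in>F. (cmod (ell2_apply (X m) x - ell2_apply (X n) x))\<^sup>2)
          \<longlonglongrightarrow> (\<Sum>x\<in>F. (cmod (ell2_apply (X m) x - L x))\<^sup>2)"
        by (intro tendsto_intros L)
      have "(\<Sum>x\<in>F. (cmod (ell2_apply (X m) x - ell2_apply (X n) x))\<^sup>2) \<le> e\<^sup>2" if "n \<ge> M" for n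
      proof -
        have "(\<Sum>x\<in>F. (cmod (ell2_apply (X m) x - ell2_apply (X n) x))\<^sup>2) \<le> (norm (X m - X n))\<^sup>2"
          using sum_squares_le_norm[OF \<open>finite F\<close>, of "X m - X n"] by (simp add: minus_ell2.rep_eq)
        also have "\<dots> \<le> e\<^sup>2"
          using M \<open>m \<ge> M\<close> \<open>n \<ge> M\<close> by (intro power_mono) (auto intro: less_imp_le)
        finally show ?thesis .
      qed
      then show "\<exists>M. \<forall>n\<ge>M. (\<Sum>x\<in>F. (cmod (ell2_apply (X m) x - ell2_apply (X n) x))\<^sup>2) \<le> e\<^sup>2"
        by blast
    qed
    then show ?thesis by blast
  qed
  obtain m where m: "\<And>F. finite F \<Longrightarrow> (\<Sum>x\<in>F. (cmod (ell2_apply (X m) x - L x))\<^sup>2) \<le> 1\<^sup>2"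
    using tail[of 1] by fastforce
  have "(\<lambda>x. (cmod (ell2_apply (X m) x - L x))\<^sup>2) summable_on UNIV"
    by (rule nonneg_bdd_above_summable_on) (use m in \<open>auto intro!: bdd_aboveI[of _ "1\<^sup>2"]\<close>)
  from square_summable_add[OF ell2_square_summable[of "X m"] square_summable_cmult[OF this, of "-1"]]
  have "(\<lambda>x. (cmod (L x))\<^sup>2) summable_on UNIV" by simp
  then have Y: "ell2_apply (Ell2 L) = L" by (simp add: Ell2_inverse)
  have "X \<longlonglongrightarrow> Ell2 L"
  proof (rule metric_LIMSEQ_I)
    fix e :: real assume "0 < e"
    then obtain M where M: "\<forall>m\<ge>M. \<forall>F. finite F \<longrightarrow>
        (\<Sum>x\<in>F. (cmod (ell2_apply (X m) x - L x))\<^sup>2) \<le> (e/2)\<^sup>2"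
      using tail[of "e/2"] by auto
    have "dist (X m) (Ell2 L) < e" if "m \<ge> M" for m
    proof -
      have "norm (X m - Ell2 L) \<le> e/2"
        by (rule norm_ell2_le) (use M that \<open>0 < e\<close> in \<open>auto simp: minus_ell2.rep_eq Y\<close>)
      with \<open>0 < e\<close> show ?thesis by (simp add: dist_norm)
    qed
    then show "\<exists>M. \<forall>m\<ge>M. dist (X m) (Ell2 L) < e" by blast
  qed
  then show "convergent X" by (auto simp: convergent_def)
qed

lemma scaleC_of_real: "of_real r *\<^sub>C f = r *\<^sub>R f"
  by (rule ell2_eqI) (simp add: scaleC.rep_eq scaleR_ell2.rep_eq)

lemma scaleC_scaleC: "a *\<^sub>C b *\<^sub>C f = (a * b) *\<^sub>C f"
  by (rule ell2_eqI) (simp add: scaleC.rep_eq)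

lemma bounded_linear_scaleC: "bounded_linear (scaleC c)"
  by (rule bounded_linear_intro[where K = "cmod c"], rule ell2_eqI, simp add: scaleC.rep_eq plus_ell2.rep_eq algebra_simps)
     (rule ell2_eqI, simp add: scaleC.rep_eq scaleR_ell2.rep_eq, simp add: norm_scaleC)

lemma cinner_summable: "(\<lambda>x. ell2_apply f x * cnj (ell2_apply g x)) summable_on UNIV"
  by (rule abs_summable_summable)
     (use square_summable_product[OF ell2_square_summable[of f] ell2_square_summable[of g]]
      in \<open>simp add: norm_mult\<close>)

text \<open>This form reduces the analytic properties of the complex inner product to those of the real
  one.\<close>

lemma cinner_eq: "cinner f g = Complex (f \<bullet> g) (f \<bullet> (\<i> *\<^sub>C g))"
proof (rule complex_eqI)
  have "Re (cinner f g) = (\<Sum>\<^sub>\<infinity>x. Re (ell2_apply f x * cnj (ell2_apply g x)))"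
    unfolding cinner.rep_eq by (rule infsum_Re[OF cinner_summable, symmetric])
  then show "Re (cinner f g) = Re (Complex (f \<bullet> g) (f \<bullet> (\<i> *\<^sub>C g)))"
    by (simp add: inner_ell2.rep_eq inner_complex_def)
  have "Im (cinner f g) = (\<Sum>\<^sub>\<infinity>x. Im (ell2_apply f x * cnj (ell2_apply g x)))"
    unfolding cinner.rep_eq by (rule infsum_Im[OF cinner_summable, symmetric])
  then show "Im (cinner f g) = Im (Complex (f \<bullet> g) (f \<bullet> (\<i> *\<^sub>C g)))"
    by (simp add: inner_ell2.rep_eq inner_complex_def scaleC.rep_eq algebra_simps)
qed

lemma cinner_commute: "cinner g f = cnj (cinner f g)"
  by (simp add: cinner.rep_eq mult.commute flip: infsum_cnj)

lemma cinner_scaleC_left: "cinner (c *\<^sub>C f) g = c * cinner f g"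
  by (simp add: cinner.rep_eq scaleC.rep_eq mult.assoc infsum_cmult_right')

lemma cinner_scaleC_right: "cinner f (c *\<^sub>C g) = cnj c * cinner f g"
  by (metis cinner_commute cinner_scaleC_left complex_cnj_cnj complex_cnj_mult)

lemma cinner_self: "cinner f f = of_real ((norm f)\<^sup>2)"
  by (rule complex_eqI)
     (use cinner_commute[of f f] in \<open>auto simp: cinner_eq complex_eq_iff power2_norm_eq_inner\<close>)

lemma norm_cinner_le: "cmod (cinner f g) \<le> norm f * norm g"
proof -
  \<comment> \<open>Rotating \<open>f\<close> by the phase \<open>u\<close> makes the complex inner product real and nonnegative.\<close>
  define u where "u = cnj (sgn (cinner f g))"
  have "u * cinner f g = of_real (cmod (cinner f g))"
    by (simp add: u_def sgn_div_norm complex_norm_square[symmetric] power2_eq_square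
        mult.commute[of "cnj _"] scaleR_conv_of_real divide_simps)
  then have "cmod (cinner f g) = Re (cinner (u *\<^sub>C f) g)"
    by (simp add: cinner_scaleC_left)
  also have "\<dots> = (u *\<^sub>C f) \<bullet> g" by (simp add: cinner_eq)
  also have "\<dots> \<le> norm (u *\<^sub>C f) * norm g" by (rule norm_cauchy_schwarz)
  also have "\<dots> \<le> norm f * norm g"
    by (intro mult_right_mono) (auto simp: norm_scaleC u_def norm_sgn)
  finally show ?thesis .
qed

lemma bounded_bilinear_cinner: "bounded_bilinear cinner"
proof (rule bounded_bilinear.intro)
  fix f f' g g' :: "'a ell2" and r :: real
  show add: "cinner (f + f') g = cinner f g + cinner f' g" for f f' g :: "'a ell2"
    by (simp add: cinner_eq inner_add_left complex_eq_iff)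
  show "cinner f (g + g') = cinner f g + cinner f g'"
    by (metis add cinner_commute complex_cnj_add)
  show "cinner (r *\<^sub>R f) g = r *\<^sub>R cinner f g"
    by (simp add: cinner_scaleC_left scaleR_conv_of_real flip: scaleC_of_real)
  show "cinner f (r *\<^sub>R g) = r *\<^sub>R cinner f g"
    by (simp add: cinner_scaleC_right scaleR_conv_of_real flip: scaleC_of_real)
  show "\<exists>K. \<forall>f g :: 'a ell2. norm (cinner f g) \<le> norm f * norm g * K"
    by (rule exI[of _ 1]) (simp add: norm_cinner_le)
qed

interpretation cinner: bounded_bilinear cinner
  by (rule bounded_bilinear_cinner)

lemma cinner_left_cancel: "(\<And>f. cinner f g = cinner f h) \<Longrightarrow> g = h"
proof -
  assume "\<And>f. cinner f g = cinner f h"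
  then have "cinner (g - h) (g - h) = 0" by (simp add: cinner.diff_right)
  then show "g = h" by (simp add: cinner_self)
qed


lemma op_scaleC_of_real: "of_real r *\<^sub>O T = r *\<^sub>R T"
  by (rule blinfun_eqI) (simp add: blinfun_apply_op_scaleC scaleC_of_real blinfun.scaleR_left)

lemma op_scaleC_op_scaleC: "a *\<^sub>O b *\<^sub>O T = (a * b) *\<^sub>O T"
  by (rule blinfun_eqI) (simp add: blinfun_apply_op_scaleC scaleC_scaleC)

lemma op_scaleC_add: "c *\<^sub>O (S + T) = c *\<^sub>O S + c *\<^sub>O T"
  by (rule blinfun_eqI)
     (simp add: blinfun_apply_op_scaleC blinfun.add_left bounded_linear_scaleC
        linear_add bounded_linear.linear)

lemma norm_op_scaleC_le: "norm (c *\<^sub>O T) \<le> cmod c * norm T"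
proof (rule norm_blinfun_bound)
  show "norm (blinfun_apply (c *\<^sub>O T) f) \<le> cmod c * norm T * norm f" for f
    using mult_left_mono[OF norm_blinfun[of T f], of "cmod c"]
    by (simp add: blinfun_apply_op_scaleC norm_scaleC mult.assoc)
qed simp

lemma bounded_linear_op_scaleC: "bounded_linear (op_scaleC c)"
proof (rule bounded_linear_intro[where K = "cmod c"])
  fix T :: "'a operator" and r :: real
  show "c *\<^sub>O r *\<^sub>R T = r *\<^sub>R c *\<^sub>O T"
    by (simp add: op_scaleC_op_scaleC mult.commute flip: op_scaleC_of_real)
  show "norm (c *\<^sub>O T) \<le> norm T * cmod c"
    using norm_op_scaleC_le[of c T] by (simp add: mult.commute)
qed (rule op_scaleC_add)


section \<open>Adjoint operators\<close>

text \<open>A relation instead of the operation \<^const>\<open>op_adj\<close>, whose value is only meaningful once an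
  adjoint is known to exist.\<close>

definition adjoint_pair :: "'a operator \<Rightarrow> 'a operator \<Rightarrow> bool"
  where "adjoint_pair T S \<longleftrightarrow>
    (\<forall>f g. cinner (blinfun_apply T f) g = cinner f (blinfun_apply S g))"

lemma adjoint_pair_sym: "adjoint_pair T S \<Longrightarrow> adjoint_pair S T"
  unfolding adjoint_pair_def by (metis cinner_commute)

lemma op_adj_eqI:
  assumes "adjoint_pair T S"
  shows "op_adj T = S"
  unfolding op_adj_def
proof (rule the_equality)
  show "\<forall>f g. cinner (blinfun_apply T f) g = cinner f (blinfun_apply S g)"
    using assms by (simp add: adjoint_pair_def)
  fix S'
  assume "\<forall>f g. cinner (blinfun_apply T f) g = cinner f (blinfun_apply S' g)"
  then have "cinner f (blinfun_apply S' g) = cinner f (blinfun_apply S g)" for f g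
    using assms by (simp add: adjoint_pair_def)
  then show "S' = S" by (intro blinfun_eqI cinner_left_cancel)
qed

lemma adjoint_pair_zero: "adjoint_pair 0 0"
  by (simp add: adjoint_pair_def cinner.zero_left cinner.zero_right)

lemma adjoint_pair_id: "adjoint_pair id_blinfun id_blinfun"
  by (simp add: adjoint_pair_def)

lemma adjoint_pair_add:
  "adjoint_pair T S \<Longrightarrow> adjoint_pair T' S' \<Longrightarrow> adjoint_pair (T + T') (S + S')"
  by (simp add: adjoint_pair_def cinner.add_left cinner.add_right blinfun.add_left)

lemma adjoint_pair_diff:
  "adjoint_pair T S \<Longrightarrow> adjoint_pair T' S' \<Longrightarrow> adjoint_pair (T - T') (S - S')"
  by (simp add: adjoint_pair_def cinner.diff_left cinner.diff_right blinfun.diff_left)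

lemma adjoint_pair_scaleC: "adjoint_pair T S \<Longrightarrow> adjoint_pair (c *\<^sub>O T) (cnj c *\<^sub>O S)"
  by (simp add: adjoint_pair_def blinfun_apply_op_scaleC cinner_scaleC_left cinner_scaleC_right)

lemma adjoint_pair_scaleR: "adjoint_pair T S \<Longrightarrow> adjoint_pair (r *\<^sub>R T) (r *\<^sub>R S)"
  using adjoint_pair_scaleC[of T S "of_real r"] by (simp add: op_scaleC_of_real)

lemma adjoint_pair_compose:
  "adjoint_pair T S \<Longrightarrow> adjoint_pair T' S' \<Longrightarrow> adjoint_pair (T o\<^sub>L T') (S' o\<^sub>L S)"
  by (simp add: adjoint_pair_def)

text \<open>From \<open>\<parallel>S g\<parallel>\<^sup>2 = \<langle>T S g, g\<rangle> \<le> \<parallel>T\<parallel> \<parallel>S g\<parallel> \<parallel>g\<parallel>\<close>. By symmetry the adjoint is isometric, so that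
  adjoints pass to norm limits.\<close>

lemma adjoint_pair_norm_le:
  assumes "adjoint_pair T S"
  shows "norm S \<le> norm T"
proof (rule norm_blinfun_bound)
  fix g
  let ?h = "blinfun_apply S g"
  have "cinner (blinfun_apply T ?h) g = of_real ((norm ?h)\<^sup>2)"
    using assms by (simp add: adjoint_pair_def cinner_self)
  then have "(norm ?h)\<^sup>2 = cmod (cinner (blinfun_apply T ?h) g)"
    by (simp del: of_real_power)
  also have "\<dots> \<le> norm (blinfun_apply T ?h) * norm g" by (rule norm_cinner_le)
  also have "\<dots> \<le> norm T * norm ?h * norm g"
    by (intro mult_right_mono norm_blinfun) simp
  finally have "norm ?h * norm ?h \<le> norm ?h * (norm T * norm g)"
    by (simp add: power2_eq_square mult.commute mult.left_commute)
  then show "norm ?h \<le> norm T * norm g"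
    by (cases "norm ?h = 0") auto
qed simp

lemma adjoint_pair_limit:
  assumes "\<And>n. adjoint_pair (T n) (S n)" "T \<longlonglongrightarrow> T'" "S \<longlonglongrightarrow> S'"
  shows "adjoint_pair T' S'"
  unfolding adjoint_pair_def
proof (intro allI LIMSEQ_unique)
  fix f g
  show "(\<lambda>n. cinner (blinfun_apply (T n) f) g) \<longlonglongrightarrow> cinner (blinfun_apply T' f) g"
    by (intro cinner.tendsto blinfun.tendsto tendsto_const assms)
  have "(\<lambda>n. cinner f (blinfun_apply (S n) g)) \<longlonglongrightarrow> cinner f (blinfun_apply S' g)"
    by (intro cinner.tendsto blinfun.tendsto tendsto_const assms)
  then show "(\<lambda>n. cinner (blinfun_apply (T n) f) g) \<longlonglongrightarrow> cinner f (blinfun_apply S' g)"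
    using assms(1) by (simp add: adjoint_pair_def)
qed

text \<open>The adjoints of a convergent sequence form a Cauchy sequence, and their limit is the adjoint
  of the limit. The existence of adjoints thus extends from the span of the translations to its
  closure.\<close>

lemma closed_adjointable:
  assumes "closed A"
  shows "closed {T. \<exists>S\<in>A. adjoint_pair T S}"
  unfolding closed_sequential_limits
proof (intro allI impI, elim conjE)
  fix T T'
  assume "\<forall>n. T n \<in> {T. \<exists>S\<in>A. adjoint_pair T S}" and lim: "T \<longlonglongrightarrow> T'"
  then obtain S where S: "\<And>n. S n \<in> A" "\<And>n. adjoint_pair (T n) (S n)" by simp metis
  have "Cauchy S"
  proof (rule metric_CauchyI)
    fix e :: real assume "0 < e"
    then obtain M where M: "\<forall>m\<ge>M. \<forall>n\<ge>M. dist (T m) (T n) < e"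
      using LIMSEQ_imp_Cauchy[OF lim] by (auto simp: Cauchy_def)
    have "dist (S m) (S n) \<le> dist (T m) (T n)" for m n
      unfolding dist_norm by (intro adjoint_pair_norm_le adjoint_pair_diff S)
    with M show "\<exists>M. \<forall>m\<ge>M. \<forall>n\<ge>M. dist (S m) (S n) < e"
      by (meson le_less_trans)
  qed
  then obtain S' where S': "S \<longlonglongrightarrow> S'"
    using Cauchy_convergent convergent_def by blast
  then have "S' \<in> A" using assms S(1) by (auto simp: closed_sequential_limits)
  with adjoint_pair_limit[OF S(2) lim S'] show "T' \<in> {T. \<exists>S\<in>A. adjoint_pair T S}" by blast
qed


section \<open>The reduced C*-algebra as the closed span of the left translations\<close>

lemma subspace_closure:
  fixes V :: "'a::real_normed_vector set"
  assumes "subspace V"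
  shows "subspace (closure V)"
proof (rule subspaceI)
  show "0 \<in> closure V" using subspace_0[OF assms] closure_subset by blast
next
  fix x y assume "x \<in> closure V" "y \<in> closure V"
  then obtain a b where "\<forall>n. a n \<in> V" "a \<longlonglongrightarrow> x" "\<forall>n. b n \<in> V" "b \<longlonglongrightarrow> y"
    by (auto simp: closure_sequential)
  then show "x + y \<in> closure V"
    unfolding closure_sequential
    by (intro exI[of _ "\<lambda>n. a n + b n"]) (auto intro: tendsto_add subspace_add[OF assms])
next
  fix c x assume "x \<in> closure V"
  then obtain a where "\<forall>n. a n \<in> V" "a \<longlonglongrightarrow> x"
    by (auto simp: closure_sequential)
  then show "c *\<^sub>R x \<in> closure V"
    unfolding closure_sequential
    by (intro exI[of _ "\<lambda>n. c *\<^sub>R a n"]) (auto intro: tendsto_scaleR subspace_scale[OF assms])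
qed

lemma closed_span_minimal:
  fixes V :: "'a::real_normed_vector set"
  assumes "subspace V" "closed V" "X \<subseteq> V"
  shows "closure (span X) \<subseteq> V"
  using assms by (intro closure_minimal span_minimal)

lemma closed_subspace_vimage:
  assumes "bounded_linear f" "subspace V" "closed V"
  shows "subspace (f -` V)" "closed (f -` V)"
proof -
  interpret bounded_linear f by fact
  show "subspace (f -` V)"
    using assms(2) by (auto simp: subspace_def zero add scaleR)
  show "closed (f -` V)"
    by (intro closed_vimage assms linear_continuous_on)
qed

lemma lreg_mult: "lreg u o\<^sub>L lreg v = lreg (u * v)"
proof (intro blinfun_eqI ell2_eqI)
  fix f x
  have "inverse (u * v) = inverse v * inverse u"
    by (metis free_group_left_inverse free_group_right_inverse mult.assoc mult_1 mult.right_neutral)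
  then show "ell2_apply (blinfun_apply (lreg u o\<^sub>L lreg v) f) x
      = ell2_apply (blinfun_apply (lreg (u * v)) f) x"
    by (simp add: blinfun_apply_lreg ell2_apply_translate mult.assoc)
qed

lemma inverse_one_free_group: "inverse 1 = (1 :: 'i free_group)"
  by (metis free_group_left_inverse mult.right_neutral)

lemma lreg_one: "lreg 1 = id_blinfun"
  by (intro blinfun_eqI ell2_eqI)
     (simp add: blinfun_apply_lreg ell2_apply_translate inverse_one_free_group)

lemma adjoint_pair_lreg: "adjoint_pair (lreg w) (lreg (inverse w))"
  unfolding adjoint_pair_def blinfun_apply_lreg
proof (intro allI)
  fix f g :: "'a free_group ell2"
  have *: "inverse (inverse w) = w"
    by (metis free_group_left_inverse mult.assoc mult_1 mult.right_neutral)
  have "cinner (translate w f) g =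
      (\<Sum>\<^sub>\<infinity>v. (\<lambda>u. ell2_apply f u * cnj (ell2_apply g (w * u))) (inverse w * v))"
    by (simp add: cinner.rep_eq ell2_apply_translate mult.assoc[symmetric] free_group_right_inverse)
  also have "\<dots> = (\<Sum>\<^sub>\<infinity>u. ell2_apply f u * cnj (ell2_apply g (w * u)))"
    by (rule infsum_reindex_bij_betw[OF bij_left_translation])
  also have "\<dots> = cinner f (translate (inverse w) g)"
    by (simp add: cinner.rep_eq ell2_apply_translate *)
  finally show "cinner (translate w f) g = cinner f (translate (inverse w) g)" .
qed

text \<open>Complex multiples are included because \<^const>\<open>span\<close> is the real linear span for operators.\<close>

definition scaled_translations :: "'i free_group operator set"
  where "scaled_translations = {c *\<^sub>O lreg w |c w. True}"

lemma scaled_translations_subset_iff: "scaled_translations \<subseteq> V \<longleftrightarrow> (\<forall>c w. c *\<^sub>O lreg w \<in> V)"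
  by (auto simp: scaled_translations_def)

lemma compose_op_scaleC:
  assumes "S \<in> cbounded"
  shows "S o\<^sub>L (c *\<^sub>O T) = c *\<^sub>O (S o\<^sub>L T)" "(c *\<^sub>O S) o\<^sub>L T = c *\<^sub>O (S o\<^sub>L T)"
  using assms by (auto intro!: blinfun_eqI simp: blinfun_apply_op_scaleC cbounded_def)

lemma closed_subspace_cbounded: "subspace cbounded" "closed cbounded"
proof -
  have eq: "cbounded = (\<Inter>c f. (\<lambda>T. blinfun_apply T (c *\<^sub>C f) - c *\<^sub>C blinfun_apply T f) -` {0})"
    by (auto simp: cbounded_def)
  have bl: "bounded_linear (\<lambda>T. blinfun_apply T (c *\<^sub>C f) - c *\<^sub>C blinfun_apply T f)" for c f
    by (intro bounded_linear_sub blinfun.bounded_linear_left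
        bounded_linear_compose[OF bounded_linear_scaleC])
  show "subspace cbounded" unfolding eq
    by (intro subspace_Inter) (auto intro!: subspace_Inter closed_subspace_vimage(1)[OF bl])
  show "closed cbounded" unfolding eq
    by (intro closed_INT ballI closed_subspace_vimage(2)[OF bl]) auto
qed

lemma lreg_cbounded: "lreg w \<in> cbounded"
  by (auto simp: cbounded_def blinfun_apply_lreg ell2_apply_translate scaleC.rep_eq intro: ell2_eqI)

lemma op_scaleC_cbounded: "T \<in> cbounded \<Longrightarrow> c *\<^sub>O T \<in> cbounded"
  by (simp add: cbounded_def blinfun_apply_op_scaleC scaleC_scaleC mult.commute)

lemma closed_span_scaled_translations_subset_cbounded: "closure (span scaled_translations) \<subseteq> cbounded"
  by (intro closed_span_minimal closed_subspace_cbounded)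
     (simp add: scaled_translations_subset_iff op_scaleC_cbounded lreg_cbounded)

lemma scaled_translations_in_closed_span: "c *\<^sub>O lreg w \<in> closure (span scaled_translations)"
  using span_superset[of scaled_translations] closure_subset[of "span scaled_translations"]
  unfolding scaled_translations_subset_iff by blast

lemma closed_span_adjointable:
  fixes T :: "'i free_group operator"
  assumes "T \<in> closure (span scaled_translations)"
  shows "\<exists>S\<in>closure (span scaled_translations). adjoint_pair T S"
proof -
  let ?A = "closure (span scaled_translations) :: 'i free_group operator set"
  have sub: "subspace ?A" by (intro subspace_closure subspace_span)
  have "?A \<subseteq> {T. \<exists>S\<in>?A. adjoint_pair T S}"
  proof (rule closed_span_minimal)
    show "subspace {T. \<exists>S\<in>?A. adjoint_pair T S}"
      by (rule subspaceI)
         (use subspace_0[OF sub] subspace_add[OF sub] subspace_scale[OF sub] adjoint_pair_zero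
            adjoint_pair_add adjoint_pair_scaleR in blast)+
    show "scaled_translations \<subseteq> {T. \<exists>S\<in>?A. adjoint_pair T S}"
      unfolding scaled_translations_subset_iff
      using adjoint_pair_scaleC[OF adjoint_pair_lreg] scaled_translations_in_closed_span by blast
  qed (simp add: closed_adjointable)
  with assms show ?thesis by blast
qed

text \<open>Each closure property says that a continuous linear map sends the closed span into itself,
  and so needs checking on scaled translations only. Multiplication is treated in one factor at a
  time.\<close>

lemma cstar_subalgebra_closed_span:
  "cstar_subalgebra (closure (span scaled_translations) :: 'i free_group operator set)"
proof -
  let ?A = "closure (span scaled_translations) :: 'i free_group operator set"
  have sub: "subspace ?A" by (intro subspace_closure subspace_span)
  have scale: "c *\<^sub>O T \<in> ?A" if "T \<in> ?A" for c and T :: "'i free_group operator"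
  proof -
    have "?A \<subseteq> op_scaleC c -` ?A"
    proof (rule closed_span_minimal)
      show "scaled_translations \<subseteq> op_scaleC c -` ?A"
        by (simp add: scaled_translations_subset_iff op_scaleC_op_scaleC scaled_translations_in_closed_span)
    qed (rule closed_subspace_vimage[OF bounded_linear_op_scaleC sub closed_closure])+
    with that show ?thesis by blast
  qed
  have comp1: "S o\<^sub>L d *\<^sub>O lreg v \<in> ?A" if "S \<in> ?A"
    for S d and v :: "'i free_group"
  proof -
    have "?A \<subseteq> (\<lambda>S. S o\<^sub>L d *\<^sub>O lreg v) -` ?A"
    proof (rule closed_span_minimal)
      show "scaled_translations \<subseteq> (\<lambda>S. S o\<^sub>L d *\<^sub>O lreg v) -` ?A"
        by (simp add: scaled_translations_subset_iff compose_op_scaleC lreg_cbounded op_scaleC_cbounded lreg_mult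
            op_scaleC_op_scaleC scaled_translations_in_closed_span)
    qed (rule closed_subspace_vimage[OF _ sub closed_closure],
         rule bounded_bilinear.bounded_linear_left[OF bounded_bilinear_blinfun_compose])+
    with that show ?thesis by blast
  qed
  have comp: "S o\<^sub>L T \<in> ?A" if "S \<in> ?A" "T \<in> ?A"
    for S T :: "'i free_group operator"
  proof -
    have "?A \<subseteq> (\<lambda>T. S o\<^sub>L T) -` ?A"
    proof (rule closed_span_minimal)
      show "scaled_translations \<subseteq> (\<lambda>T. S o\<^sub>L T) -` ?A"
        using comp1 that by (simp add: scaled_translations_subset_iff)
    qed (rule closed_subspace_vimage[OF _ sub closed_closure],
         rule bounded_bilinear.bounded_linear_right[OF bounded_bilinear_blinfun_compose])+
    with that show ?thesis by blast
  qed
  have "op_adj T \<in> ?A" if "T \<in> ?A" for T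
    using closed_span_adjointable[OF that] op_adj_eqI by blast
  with scale comp closed_span_scaled_translations_subset_cbounded show ?thesis
    unfolding cstar_subalgebra_def by (auto simp: subspace_0[OF sub] subspace_add[OF sub])
qed

lemma cstar_subalgebra_subspace: "cstar_subalgebra A \<Longrightarrow> subspace A"
  unfolding cstar_subalgebra_def by (rule subspaceI) (auto simp flip: op_scaleC_of_real)

lemma reduced_cstar_eq_closed_span: "reduced_cstar = closure (span scaled_translations)"
proof
  have "lreg w \<in> closure (span scaled_translations)" for w :: "'i free_group"
    using scaled_translations_in_closed_span[of 1 w] op_scaleC_of_real[of 1 "lreg w"] by simp
  then show "reduced_cstar \<subseteq> (closure (span scaled_translations) :: 'i free_group operator set)"
    unfolding reduced_cstar_def cstar_generated_def
    using cstar_subalgebra_closed_span by blast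
  show "closure (span scaled_translations) \<subseteq> (reduced_cstar :: 'i free_group operator set)"
    unfolding reduced_cstar_def cstar_generated_def
  proof (rule Inter_greatest)
    fix A :: "'i free_group operator set"
    assume "A \<in> {A. cstar_subalgebra A \<and> range lreg \<subseteq> A}"
    then have A: "cstar_subalgebra A" "range lreg \<subseteq> A" by auto
    show "closure (span scaled_translations) \<subseteq> A"
    proof (rule closed_span_minimal[OF cstar_subalgebra_subspace[OF A(1)]])
      show "closed A" using A(1) by (simp add: cstar_subalgebra_def)
      show "scaled_translations \<subseteq> A"
        using A by (simp add: scaled_translations_subset_iff cstar_subalgebra_def image_subset_iff)
    qed
  qed
qed

lemma
  shows closed_reduced_cstar: "closed reduced_cstar"
    and subspace_reduced_cstar: "subspace reduced_cstar"
    and reduced_cstar_compose: "S \<in> reduced_cstar \<Longrightarrow> T \<in> reduced_cstar \<Longrightarrow> S o\<^sub>L T \<in> reduced_cstar"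
    and reduced_cstar_scaleC: "T \<in> reduced_cstar \<Longrightarrow> c *\<^sub>O T \<in> reduced_cstar"
    and reduced_cstar_adj: "T \<in> reduced_cstar \<Longrightarrow> op_adj T \<in> reduced_cstar"
  using cstar_subalgebra_closed_span cstar_subalgebra_subspace
  unfolding reduced_cstar_eq_closed_span cstar_subalgebra_def by blast+

lemma lreg_reduced_cstar: "lreg w \<in> reduced_cstar"
  unfolding reduced_cstar_def cstar_generated_def by blast

lemma id_reduced_cstar: "id_blinfun \<in> reduced_cstar"
  using lreg_reduced_cstar[of 1] by (simp add: lreg_one)

lemma adjoint_pair_op_adj: "T \<in> reduced_cstar \<Longrightarrow> adjoint_pair T (op_adj T)"
  using closed_span_adjointable op_adj_eqI unfolding reduced_cstar_eq_closed_span by blast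

lemma reduced_cstar_subsetI:
  assumes "subspace V" "closed V" "\<And>c w. c *\<^sub>O lreg w \<in> V"
  shows "reduced_cstar \<subseteq> V"
  unfolding reduced_cstar_eq_closed_span
  by (intro closed_span_minimal assms) (simp add: scaled_translations_subset_iff assms)


section \<open>Square roots and automatic continuity\<close>

lemma compose_id_blinfun [simp]: "id_blinfun o\<^sub>L T = T" "T o\<^sub>L id_blinfun = T"
  by (auto intro: blinfun_eqI)

lemma closed_selfadjoint: "closed {X. adjoint_pair X X}"
  unfolding closed_sequential_limits by (auto intro: adjoint_pair_limit)

text \<open>If \<open>X = (H + X\<^sup>2) / 2\<close> then \<open>(1 - X)\<^sup>2 = 1 - H\<close>. The map \<open>X \<mapsto> (H + X\<^sup>2) / 2\<close> preserves the
  self-adjoint elements of norm at most \<open>r = \<parallel>H\<parallel>\<close>, because \<open>(r + r\<^sup>2) / 2 \<le> r\<close>. There it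
  contracts distances by the factor \<open>r\<close>, since \<open>X\<^sup>2 - Y\<^sup>2 = X (X - Y) + (X - Y) Y\<close>.\<close>

lemma exists_sqrt_one_minus:
  assumes H: "H \<in> reduced_cstar" "adjoint_pair H H" and "norm H < 1"
  shows "\<exists>S\<in>reduced_cstar. adjoint_pair S S \<and> S o\<^sub>L S = id_blinfun - H"
proof -
  interpret comp: bounded_bilinear "blinfun_compose :: 'a free_group operator \<Rightarrow> _"
    by (rule bounded_bilinear_blinfun_compose)
  define r where "r = norm H"
  define B where "B = reduced_cstar \<inter> {X. adjoint_pair X X} \<inter> cball (0 :: 'a free_group operator) r"
  define F where "F X = (1/2) *\<^sub>R (H + (X o\<^sub>L X))" for X
  have r: "0 \<le> r" "r < 1" using assms by (auto simp: r_def)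
  have "\<exists>!X\<in>B. F X = X"
  proof (rule Banach_fix[where c = r])
    show "complete B" unfolding B_def complete_eq_closed
      by (intro closed_Int closed_reduced_cstar closed_selfadjoint closed_cball)
    show "B \<noteq> {}"
      using subspace_0[OF subspace_reduced_cstar] adjoint_pair_zero r by (auto simp: B_def)
    show "F ` B \<subseteq> B"
    proof (rule image_subsetI)
      fix X assume "X \<in> B"
      then have X: "X \<in> reduced_cstar" "adjoint_pair X X" "norm X \<le> r" by (auto simp: B_def)
      have "norm (H + (X o\<^sub>L X)) \<le> r + norm X * norm X"
        using norm_blinfun_compose[of X X] norm_triangle_ineq[of H "X o\<^sub>L X"]
        unfolding r_def by linarith
      also have "\<dots> \<le> r + r * 1" using X r by (intro add_left_mono mult_mono) auto
      finally have "norm (F X) \<le> r" by (simp add: F_def)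
      moreover have "F X \<in> reduced_cstar"
        unfolding F_def using H X
        by (intro subspace_scale[OF subspace_reduced_cstar] subspace_add[OF subspace_reduced_cstar]
            reduced_cstar_compose)
      moreover have "adjoint_pair (F X) (F X)"
        unfolding F_def using H X
        by (intro adjoint_pair_scaleR adjoint_pair_add adjoint_pair_compose)
      ultimately show "F X \<in> B" by (simp add: B_def)
    qed
    fix X Y assume "X \<in> B" "Y \<in> B"
    then have XY: "norm X \<le> r" "norm Y \<le> r" by (auto simp: B_def)
    have "F X - F Y = (1/2) *\<^sub>R ((X o\<^sub>L (X - Y)) + ((X - Y) o\<^sub>L Y))"
      by (simp add: F_def comp.diff_left comp.diff_right algebra_simps)
    moreover have "norm ((X o\<^sub>L (X - Y)) + ((X - Y) o\<^sub>L Y)) \<le> r * norm (X - Y) + norm (X - Y) * r"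
      using XY r by (intro norm_triangle_mono order_trans[OF norm_blinfun_compose] mult_mono) auto
    ultimately show "dist (F X) (F Y) \<le> r * dist X Y" by (simp add: dist_norm)
  qed (use r in auto)
  then obtain X where X: "X \<in> reduced_cstar" "adjoint_pair X X" "F X = X" by (auto simp: B_def)
  then have "H + (X o\<^sub>L X) = 2 *\<^sub>R X" by (metis F_def scaleR_half_double scaleR_2 scaleR_right_distrib)
  then have "(id_blinfun - X) o\<^sub>L (id_blinfun - X) = id_blinfun - H"
    by (simp add: comp.diff_left comp.diff_right scaleR_2 algebra_simps)
  moreover have "id_blinfun - X \<in> reduced_cstar"
    by (intro subspace_diff[OF subspace_reduced_cstar] id_reduced_cstar X)
  moreover have "adjoint_pair (id_blinfun - X) (id_blinfun - X)"
    by (intro adjoint_pair_diff adjoint_pair_id X)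
  ultimately show ?thesis by blast
qed

lemma
  assumes "state_on reduced_cstar \<phi>"
  shows state_add: "S \<in> reduced_cstar \<Longrightarrow> T \<in> reduced_cstar \<Longrightarrow> \<phi> (S + T) = \<phi> S + \<phi> T"
    and state_scaleC: "T \<in> reduced_cstar \<Longrightarrow> \<phi> (c *\<^sub>O T) = c * \<phi> T"
    and state_scaleR: "T \<in> reduced_cstar \<Longrightarrow> \<phi> (r *\<^sub>R T) = of_real r * \<phi> T"
    and state_id: "\<phi> id_blinfun = 1"
    and state_nonneg: "T \<in> reduced_cstar \<Longrightarrow> \<phi> (op_adj T o\<^sub>L T) \<in> \<real>\<^sub>\<ge>\<^sub>0"
  using assms by (auto simp: state_on_def simp flip: op_scaleC_of_real)

text \<open>The state is nonnegative at \<open>1 - H / c\<close>, which is a square. Membership in the nonnegative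
  reals also shows that \<open>\<phi> H\<close> is real.\<close>

lemma state_le_norm:
  assumes "state_on reduced_cstar \<phi>" "H \<in> reduced_cstar" "adjoint_pair H H" "norm H < c"
  shows "of_real c - \<phi> H \<in> \<real>\<^sub>\<ge>\<^sub>0"
proof -
  have c: "0 < c" using assms(4) norm_ge_zero[of H] by linarith
  let ?H = "(- 1 / c) *\<^sub>R H"
  have H: "?H \<in> reduced_cstar"
    using assms subspace_scale[OF subspace_reduced_cstar] by blast
  have "\<exists>S\<in>reduced_cstar. adjoint_pair S S \<and> S o\<^sub>L S = id_blinfun - (1 / c) *\<^sub>R H"
    using assms c by (intro exists_sqrt_one_minus)
      (auto intro: subspace_scale[OF subspace_reduced_cstar] adjoint_pair_scaleR)
  then obtain S where S: "S \<in> reduced_cstar" "adjoint_pair S S" "S o\<^sub>L S = id_blinfun + ?H" by auto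
  then have "\<phi> (id_blinfun + ?H) \<in> \<real>\<^sub>\<ge>\<^sub>0"
    using state_nonneg[OF assms(1) S(1)] by (simp add: op_adj_eqI)
  then have "1 - \<phi> H / of_real c \<in> \<real>\<^sub>\<ge>\<^sub>0"
    by (simp only: state_add[OF assms(1) id_reduced_cstar H] state_scaleR[OF assms(1,2)]
        state_id[OF assms(1)]) simp
  then have "of_real c * (1 - \<phi> H / of_real c) \<in> \<real>\<^sub>\<ge>\<^sub>0"
    using c by (intro nonneg_Reals_mult_I) auto
  with c show ?thesis by (simp add: right_diff_distrib)
qed

lemma state_selfadjoint_norm_le:
  assumes "state_on reduced_cstar \<phi>" "H \<in> reduced_cstar" "adjoint_pair H H"
  shows "cmod (\<phi> H) \<le> norm H"
proof (rule dense_ge)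
  fix c assume c: "norm H < c"
  have "of_real c - \<phi> H \<in> \<real>\<^sub>\<ge>\<^sub>0" by (rule state_le_norm[OF assms c])
  moreover have "of_real c - \<phi> ((-1) *\<^sub>R H) \<in> \<real>\<^sub>\<ge>\<^sub>0"
    by (rule state_le_norm[OF assms(1)])
       (use assms c subspace_scale[OF subspace_reduced_cstar, of H "-1"]
          adjoint_pair_scaleR[of H H "-1"] in auto)
  ultimately show "cmod (\<phi> H) \<le> c"

    unfolding state_scaleR[OF assms(1,2)] by (auto simp: complex_nonneg_Reals_iff cmod_def)
qed

lemma state_positive_le:
  assumes "state_on reduced_cstar \<phi>" "T \<in> reduced_cstar"
  shows "cmod (\<phi> (op_adj T o\<^sub>L T)) \<le> (norm T)\<^sup>2"
proof -
  have adj: "adjoint_pair T (op_adj T)" by (rule adjoint_pair_op_adj[OF assms(2)])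
  have "cmod (\<phi> (op_adj T o\<^sub>L T)) \<le> norm (op_adj T o\<^sub>L T)"
    by (intro state_selfadjoint_norm_le assms reduced_cstar_compose reduced_cstar_adj
        adjoint_pair_compose adj adjoint_pair_sym[OF adj])
  also have "\<dots> \<le> norm (op_adj T) * norm T" by (rule norm_blinfun_compose)
  also have "\<dots> \<le> norm T * norm T"
    by (intro mult_right_mono adjoint_pair_norm_le[OF adj]) simp
  finally show ?thesis by (simp add: power2_eq_square)
qed

text \<open>The factor 2 comes from splitting \<open>T = H + \<i> K\<close> into self-adjoint parts.\<close>

lemma state_norm_le:
  assumes \<phi>: "state_on reduced_cstar \<phi>" and T: "T \<in> reduced_cstar"
  shows "cmod (\<phi> T) \<le> 2 * norm T"
proof -
  have adj: "adjoint_pair T (op_adj T)" by (rule adjoint_pair_op_adj[OF T])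
  note adj' = adjoint_pair_sym[OF adj]
  define H where "H = (1/2) *\<^sub>R (T + op_adj T)"
  define K where "K = (- \<i> / 2) *\<^sub>O (T - op_adj T)"
  have mem: "H \<in> reduced_cstar" "K \<in> reduced_cstar"
    unfolding H_def K_def
    by (intro subspace_scale[OF subspace_reduced_cstar] subspace_add[OF subspace_reduced_cstar]
        subspace_diff[OF subspace_reduced_cstar] reduced_cstar_scaleC reduced_cstar_adj T)+
  have "adjoint_pair H H"
    using adjoint_pair_scaleR[OF adjoint_pair_add[OF adj adj']] by (simp add: H_def add.commute)
  then have "cmod (\<phi> H) \<le> norm H" by (intro state_selfadjoint_norm_le \<phi> mem)
  also have "\<dots> \<le> norm T"
    using norm_triangle_ineq[of T "op_adj T"] adjoint_pair_norm_le[OF adj] by (simp add: H_def)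
  finally have H: "cmod (\<phi> H) \<le> norm T" .
  have "(\<i> / 2) *\<^sub>O (op_adj T - T) = K"
    by (rule blinfun_eqI, rule ell2_eqI)
       (simp add: K_def blinfun_apply_op_scaleC blinfun.diff_left scaleC.rep_eq minus_ell2.rep_eq
          algebra_simps)
  then have "adjoint_pair K K"
    using adjoint_pair_scaleC[OF adjoint_pair_diff[OF adj adj'], of "- \<i> / 2"] by (simp add: K_def)
  then have "cmod (\<phi> K) \<le> norm K" by (intro state_selfadjoint_norm_le \<phi> mem)
  also have "\<dots> \<le> norm T"
    using norm_triangle_ineq4[of T "op_adj T"] adjoint_pair_norm_le[OF adj]
      norm_op_scaleC_le[of "- \<i> / 2" "T - op_adj T"] by (simp add: K_def)
  finally have K: "cmod (\<phi> K) \<le> norm T" .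
  have "T = H + \<i> *\<^sub>O K"
    by (rule blinfun_eqI, rule ell2_eqI)
       (simp add: H_def K_def blinfun_apply_op_scaleC blinfun.diff_left blinfun.add_left
         blinfun.scaleR_left scaleC.rep_eq minus_ell2.rep_eq plus_ell2.rep_eq scaleR_ell2.rep_eq
          field_simps)
  then have "\<phi> T = \<phi> H + \<i> * \<phi> K"
    using state_add[OF \<phi> mem(1) reduced_cstar_scaleC[OF mem(2)], of \<i>] state_scaleC[OF \<phi> mem(2)]
    by simp
  then have "cmod (\<phi> T) \<le> cmod (\<phi> H) + cmod (\<phi> K)"
    using norm_triangle_ineq[of "\<phi> H" "\<i> * \<phi> K"] by (simp add: norm_mult)
  with H K show ?thesis by linarith
qed

text \<open>The density argument behind both uniqueness statements. The map is linear and bounded only on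
  the algebra, where states and automorphisms are controlled, hence the relativised
  hypotheses.\<close>

lemma vanishes_on_reduced_cstar:
  fixes d :: "'i free_group operator \<Rightarrow> 'b::real_normed_vector"
  assumes add: "\<And>S T. S \<in> reduced_cstar \<Longrightarrow> T \<in> reduced_cstar \<Longrightarrow> d (S + T) = d S + d T"
    and scale: "\<And>r T. T \<in> reduced_cstar \<Longrightarrow> d (r *\<^sub>R T) = r *\<^sub>R d T"
    and bound: "\<And>T. T \<in> reduced_cstar \<Longrightarrow> norm (d T) \<le> K * norm T"
    and zero: "\<And>c w. d (c *\<^sub>O lreg w) = 0"
    and T: "T \<in> reduced_cstar"
  shows "d T = 0"
proof -
  let ?A = "reduced_cstar :: 'i free_group operator set"
  note sub = subspace_reduced_cstar
  have "?A \<subseteq> {T \<in> ?A. d T = 0}"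
  proof (rule reduced_cstar_subsetI)
    show "subspace {T \<in> ?A. d T = 0}"
      using subspace_0[OF sub] scale[of 0 0]
      by (auto intro!: subspaceI subspace_add[OF sub] subspace_scale[OF sub] simp: add scale)
    show "c *\<^sub>O lreg w \<in> {T \<in> ?A. d T = 0}" for c w
      by (simp add: zero reduced_cstar_scaleC lreg_reduced_cstar)
    show "closed {T \<in> ?A. d T = 0}"
      unfolding closed_sequential_limits
    proof (intro allI impI, elim conjE)
      fix T T' assume "\<forall>n. T n \<in> {T \<in> ?A. d T = 0}" and lim: "T \<longlonglongrightarrow> T'"
      then have T: "\<And>n. T n \<in> ?A" "\<And>n. d (T n) = 0" by auto
      then have T': "T' \<in> ?A" using closed_reduced_cstar lim by (auto simp: closed_sequential_limits)
      have "norm (d T') \<le> K * norm (T' - T n)" for n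
      proof -
        have "d T' = d (T' - T n)"
          using add[OF subspace_diff[OF sub T' T(1)] T(1), of n n] T(2) by simp
        then show ?thesis using bound[OF subspace_diff[OF sub T' T(1)]] by simp
      qed
      moreover have "(\<lambda>n. K * norm (T' - T n)) \<longlonglongrightarrow> K * norm (T' - T')"
        by (intro tendsto_intros lim)
      ultimately have "norm (d T') \<le> K * norm (T' - T')"
        by (intro LIMSEQ_le_const) auto
      with T' show "T' \<in> {T \<in> ?A. d T = 0}" by simp
    qed
  qed
  with T show ?thesis by blast
qed

lemma state_eqI:
  assumes "state_on reduced_cstar \<phi>" "state_on reduced_cstar \<psi>"
    and "\<And>w. \<phi> (lreg w) = \<psi> (lreg w)" "T \<in> reduced_cstar"
  shows "\<phi> T = \<psi> T"
proof -
  have "\<phi> T - \<psi> T = 0"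
  proof (rule vanishes_on_reduced_cstar[where d = "\<lambda>T. \<phi> T - \<psi> T" and K = 4])
    fix T :: "'a free_group operator"
    assume "T \<in> reduced_cstar"
    then show "norm (\<phi> T - \<psi> T) \<le> 4 * norm T"
      using state_norm_le[OF assms(1)] state_norm_le[OF assms(2)] norm_triangle_ineq4[of "\<phi> T" "\<psi> T"]
      by fastforce
  qed (use assms in \<open>auto simp: state_add state_scaleR state_scaleC lreg_reduced_cstar
        scaleR_conv_of_real algebra_simps\<close>)
  then show ?thesis by simp
qed

lemma
  assumes "cstar_automorphism reduced_cstar \<alpha>"
  shows automorphism_add:
      "S \<in> reduced_cstar \<Longrightarrow> T \<in> reduced_cstar \<Longrightarrow> \<alpha> (S + T) = \<alpha> S + \<alpha> T"
    and automorphism_compose: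
      "S \<in> reduced_cstar \<Longrightarrow> T \<in> reduced_cstar \<Longrightarrow> \<alpha> (S o\<^sub>L T) = \<alpha> S o\<^sub>L \<alpha> T"
    and automorphism_scaleC: "T \<in> reduced_cstar \<Longrightarrow> \<alpha> (c *\<^sub>O T) = c *\<^sub>O \<alpha> T"
    and automorphism_scaleR: "T \<in> reduced_cstar \<Longrightarrow> \<alpha> (r *\<^sub>R T) = r *\<^sub>R \<alpha> T"
    and automorphism_adj: "T \<in> reduced_cstar \<Longrightarrow> \<alpha> (op_adj T) = op_adj (\<alpha> T)"
    and automorphism_mem: "T \<in> reduced_cstar \<Longrightarrow> \<alpha> T \<in> reduced_cstar"
  using assms
  by (auto simp: cstar_automorphism_def bij_betw_def simp flip: op_scaleC_of_real)

text \<open>The image of the unit is a unit for the range, which contains the identity operator.\<close>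

lemma automorphism_id:
  assumes "cstar_automorphism reduced_cstar \<alpha>"
  shows "\<alpha> id_blinfun = id_blinfun"
proof -
  obtain S where S: "S \<in> reduced_cstar" "\<alpha> S = id_blinfun"
    using assms id_reduced_cstar unfolding cstar_automorphism_def bij_betw_def
    by (metis imageE)
  then show ?thesis
    using automorphism_compose[OF assms S(1) id_reduced_cstar] by simp
qed

text \<open>For a unit vector \<open>f\<close> the functional \<open>T \<mapsto> \<langle>\<alpha>(T) f, f\<rangle>\<close> is a state, and its value at \<open>T\<^sup>* T\<close> is
  \<open>\<parallel>\<alpha>(T) f\<parallel>\<^sup>2\<close>. So the bound for states gives \<open>\<parallel>\<alpha>(T) f\<parallel> \<le> \<parallel>T\<parallel>\<close>.\<close>

lemma automorphism_norm_le:
  assumes \<alpha>: "cstar_automorphism reduced_cstar \<alpha>" and T: "T \<in> reduced_cstar"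
  shows "norm (\<alpha> T) \<le> norm T"
proof (rule norm_blinfun_bound)
  fix f
  have unit: "norm (blinfun_apply (\<alpha> T) f) \<le> norm T" if "norm f = 1" for f
  proof -
    define \<phi> where "\<phi> T = cinner (blinfun_apply (\<alpha> T) f) f" for T
    have pos: "\<phi> (op_adj T o\<^sub>L T) = of_real ((norm (blinfun_apply (\<alpha> T) f))\<^sup>2)"
      if "T \<in> reduced_cstar" for T
    proof -
      have "adjoint_pair (op_adj (\<alpha> T)) (\<alpha> T)"
        by (rule adjoint_pair_sym[OF adjoint_pair_op_adj[OF automorphism_mem[OF \<alpha> that]]])
      then have "cinner (blinfun_apply (op_adj (\<alpha> T)) (blinfun_apply (\<alpha> T) f)) f
          = of_real ((norm (blinfun_apply (\<alpha> T) f))\<^sup>2)"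
        unfolding adjoint_pair_def by (simp only: cinner_self)
      then show ?thesis
        using that by (simp add: \<phi>_def automorphism_compose[OF \<alpha>] automorphism_adj[OF \<alpha>]
            reduced_cstar_adj)
    qed
    have "state_on reduced_cstar \<phi>"
      unfolding state_on_def
    proof (intro conjI ballI allI)
      show "\<phi> (op_adj T o\<^sub>L T) \<in> \<real>\<^sub>\<ge>\<^sub>0" if "T \<in> reduced_cstar" for T
        unfolding pos[OF that] by (simp add: complex_nonneg_Reals_iff del: of_real_power)
    qed (simp_all add: \<phi>_def automorphism_id[OF \<alpha>] automorphism_add[OF \<alpha>]
        automorphism_scaleC[OF \<alpha>] blinfun.add_left cinner.add_left blinfun_apply_op_scaleC
        cinner_scaleC_left cinner_self that)
    from state_positive_le[OF this T]
    have "(norm (blinfun_apply (\<alpha> T) f))\<^sup>2 \<le> (norm T)\<^sup>2"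
      by (simp add: pos[OF T] del: of_real_power)
    then show ?thesis by (rule power2_le_imp_le) simp
  qed
  show "norm (blinfun_apply (\<alpha> T) f) \<le> norm T * norm f"
  proof (cases "f = 0")
    case False
    have "norm (blinfun_apply (\<alpha> T) (sgn f)) \<le> norm T"
      using False by (intro unit) (simp add: norm_sgn)
    with False show ?thesis
      by (simp add: sgn_div_norm blinfun.scaleR_right divide_simps)
  qed simp
qed simp

lemma free_group_induct [case_names one gen inv_gen]:
  fixes P :: "'i free_group \<Rightarrow> bool"
  assumes "P 1" "\<And>i w. P w \<Longrightarrow> P (free_gen i * w)" "\<And>i w. P w \<Longrightarrow> P (inverse (free_gen i) * w)"
  shows "P w"
proof -
  have "P (Free_group xs)" if "reduced xs" for xs
    using that
  proof (induction xs)
    case Nil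
    then show ?case using assms(1) by (simp add: one_free_group_def)
  next
    case (Cons x xs)
    have xs: "reduced xs" using Cons.prems by (rule reduced_ConsD)
    have push: "push x xs = x # xs" using Cons.prems by (cases xs) auto
    obtain i b where x: "x = (i, b)" by (cases x)
    have "Free_group (x # xs) = (if b then free_gen i else inverse (free_gen i)) * Free_group xs"
      using push Cons.prems xs
      unfolding x
      by (cases b; intro letters_inject[THEN iffD1];
          simp add: times_free_group.rep_eq free_gen.rep_eq inverse_free_group.rep_eq
            Free_group_inverse rmult_def rinv_def inv_letter_def)
    with assms(2,3) Cons.IH[OF xs] show ?case by simp
  qed
  from this[of "letters w"] show ?thesis using letters[of w] by (simp add: letters_inverse)
qed

lemma automorphism_eqI:
  assumes \<alpha>: "cstar_automorphism reduced_cstar \<alpha>" and \<beta>: "cstar_automorphism reduced_cstar \<beta>"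
    and gen: "\<And>i. \<alpha> (lreg (free_gen i)) = \<beta> (lreg (free_gen i))" and T: "T \<in> reduced_cstar"
  shows "\<alpha> T = \<beta> T"
proof -
  have mult: "\<gamma> (lreg (u * v)) = \<gamma> (lreg u) o\<^sub>L \<gamma> (lreg v)"
    if "cstar_automorphism reduced_cstar \<gamma>" for \<gamma> and u v :: "'a free_group"
    using automorphism_compose[OF that lreg_reduced_cstar lreg_reduced_cstar] by (simp add: lreg_mult)
  have inv: "\<gamma> (lreg (inverse u)) = op_adj (\<gamma> (lreg u))"
    if "cstar_automorphism reduced_cstar \<gamma>" for \<gamma> and u :: "'a free_group"
    using automorphism_adj[OF that lreg_reduced_cstar] by (metis op_adj_eqI adjoint_pair_lreg)
  have lreg: "\<alpha> (lreg w) = \<beta> (lreg w)" for w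
  proof (induction w rule: free_group_induct)
    case one
    show ?case by (simp add: lreg_one automorphism_id[OF \<alpha>] automorphism_id[OF \<beta>])
  qed (simp_all add: mult[OF \<alpha>] mult[OF \<beta>] inv[OF \<alpha>] inv[OF \<beta>] gen)
  have "\<alpha> T - \<beta> T = 0"
  proof (rule vanishes_on_reduced_cstar[where d = "\<lambda>T. \<alpha> T - \<beta> T" and K = 2])
    fix T :: "'a free_group operator"
    assume "T \<in> reduced_cstar"
    then show "norm (\<alpha> T - \<beta> T) \<le> 2 * norm T"
      using automorphism_norm_le[OF \<alpha>] automorphism_norm_le[OF \<beta>] norm_triangle_ineq4[of "\<alpha> T" "\<beta> T"]
      by fastforce
  qed (use assms lreg in \<open>auto simp: automorphism_add automorphism_scaleR automorphism_scaleC
        lreg_reduced_cstar algebra_simps\<close>)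
  then show ?thesis by simp
qed


section \<open>The canonical trace\<close>

lift_definition delta :: "'a \<Rightarrow> 'a ell2" is "\<lambda>a x. if x = a then 1 else 0"
proof -
  fix a :: 'a
  have "(\<lambda>x. (cmod (if x = a then 1 else 0))\<^sup>2) summable_on {a}" by simp
  then show "(\<lambda>x. (cmod (if x = a then 1 else 0))\<^sup>2) summable_on UNIV"
    by (rule summable_on_cong_neutral[THEN iffD1, rotated -1]) auto
qed

lemma cinner_delta: "cinner f (delta a) = ell2_apply f a"
proof -
  have "(\<Sum>\<^sub>\<infinity>x. ell2_apply f x * cnj (ell2_apply (delta a) x)) =
      (\<Sum>\<^sub>\<infinity>x\<in>{a}. ell2_apply f x * cnj (ell2_apply (delta a) x))"
    by (rule infsum_cong_neutral) (auto simp: delta.rep_eq)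
  then show ?thesis by (simp add: cinner.rep_eq delta.rep_eq)
qed

lemma translate_delta: "translate w (delta v) = delta (w * v)"
proof (rule ell2_eqI)
  fix x
  have "inverse w * x = v \<longleftrightarrow> x = w * v"
    by (metis free_group_left_inverse free_group_right_inverse mult.assoc mult_1)
  then show "ell2_apply (translate w (delta v)) x = ell2_apply (delta (w * v)) x"
    by (simp add: ell2_apply_translate delta.rep_eq)
qed

text \<open>The matrix coefficient \<open>\<langle>T \<delta>\<^sub>1, \<delta>\<^sub>1\<rangle>\<close>, which is the trace on the reduced C*-algebra; being defined
  and linear on all operators, it is easier to handle than \<^const>\<open>canonical_trace\<close>.\<close>

definition vector_trace :: "'i free_group operator \<Rightarrow> complex"
  where "vector_trace T = ell2_apply (blinfun_apply T (delta 1)) 1"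

lemma vector_trace_eq_cinner:
  "vector_trace = (\<lambda>T. cinner (blinfun_apply T (delta 1)) (delta 1))"
  by (simp add: fun_eq_iff vector_trace_def cinner_delta)

lemma bounded_linear_vector_trace: "bounded_linear vector_trace"
  unfolding vector_trace_eq_cinner
  by (rule bounded_linear_compose[OF cinner.bounded_linear_left blinfun.bounded_linear_left])

lemma vector_trace_scaleC: "vector_trace (c *\<^sub>O T) = c * vector_trace T"
  by (simp add: vector_trace_def blinfun_apply_op_scaleC scaleC.rep_eq)

lemma vector_trace_lreg: "vector_trace (lreg w) = (if w = 1 then 1 else 0)"
  by (auto simp: vector_trace_def blinfun_apply_lreg translate_delta delta.rep_eq)

lemma state_on_vector_trace: "state_on reduced_cstar vector_trace"
  unfolding state_on_def
proof (intro conjI ballI allI)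
  fix T :: "'a free_group operator" assume "T \<in> reduced_cstar"
  then have "adjoint_pair (op_adj T) T" by (rule adjoint_pair_sym[OF adjoint_pair_op_adj])
  then have "vector_trace (op_adj T o\<^sub>L T) = of_real ((norm (blinfun_apply T (delta 1)))\<^sup>2)"
    unfolding vector_trace_def adjoint_pair_def cinner_delta[symmetric] blinfun_apply_blinfun_compose
    by (simp only: cinner_self)
  then show "vector_trace (op_adj T o\<^sub>L T) \<in> \<real>\<^sub>\<ge>\<^sub>0"
    by (simp add: complex_nonneg_Reals_iff del: of_real_power)
qed (simp_all add: vector_trace_scaleC linear_add[OF bounded_linear.linear[OF bounded_linear_vector_trace]]
    vector_trace_lreg flip: lreg_one)

text \<open>On translations this says that \<open>u v = 1\<close> if and only if \<open>v u = 1\<close>; density is applied in each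
  factor in turn.\<close>

lemma tracial_on_vector_trace: "tracial_on reduced_cstar vector_trace"
proof -
  interpret comp: bounded_bilinear "blinfun_compose :: 'a free_group operator \<Rightarrow> _"
    by (rule bounded_bilinear_blinfun_compose)
  define D where "D S T = vector_trace ((S o\<^sub>L T) - (T o\<^sub>L S))" for S T :: "'a free_group operator"
  have bl: "bounded_linear (D S)" "bounded_linear (\<lambda>S. D S T)" for S T
    unfolding D_def
    by (intro bounded_linear_compose[OF bounded_linear_vector_trace] bounded_linear_sub
        comp.bounded_linear_left comp.bounded_linear_right)+
  have eq1: "u * v = 1 \<longleftrightarrow> v * u = 1" for u v :: "'a free_group"
    by (metis free_group_left_inverse free_group_right_inverse mult.assoc mult_1 mult.right_neutral)
  have "D (c *\<^sub>O lreg u) (d *\<^sub>O lreg v) = 0" for c d u v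
    by (simp add: D_def linear_diff[OF bounded_linear.linear[OF bounded_linear_vector_trace]]
        compose_op_scaleC lreg_cbounded op_scaleC_cbounded lreg_mult vector_trace_scaleC
        vector_trace_lreg eq1[of u v])
  then have "reduced_cstar \<subseteq> (\<lambda>S. D S (d *\<^sub>O lreg v)) -` {0}" for d v
    by (intro reduced_cstar_subsetI closed_subspace_vimage[OF bl(2)]) auto
  then have "reduced_cstar \<subseteq> D S -` {0}" if "S \<in> reduced_cstar" for S
    using that by (intro reduced_cstar_subsetI closed_subspace_vimage[OF bl(1)]) auto
  then have "D S T = 0" if "S \<in> reduced_cstar" "T \<in> reduced_cstar" for S T
    using that by blast
  then show ?thesis
    by (simp add: tracial_on_def D_def
        linear_diff[OF bounded_linear.linear[OF bounded_linear_vector_trace]])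
qed

lemma state_on_cong:
  assumes "\<And>T. T \<in> reduced_cstar \<Longrightarrow> \<psi> T = \<phi> T" "state_on reduced_cstar \<phi>"
  shows "state_on reduced_cstar \<psi>"
  using assms(2)
  by (simp add: state_on_def assms(1) id_reduced_cstar reduced_cstar_compose reduced_cstar_adj
      reduced_cstar_scaleC subspace_add[OF subspace_reduced_cstar])

text \<open>Uniqueness holds because a state is continuous and hence determined by its values at the
  translations.\<close>

lemma canonical_trace_eq:
  fixes T :: "'i free_group operator"
  assumes "T \<in> reduced_cstar"
  shows "canonical_trace T = vector_trace T"
proof -
  let ?A = "reduced_cstar :: 'i free_group operator set"
  let ?\<tau> = "restrict vector_trace ?A"
  have eq: "canonical_trace = ?\<tau>"
    unfolding canonical_trace_def
  proof (rule the_equality, intro conjI allI impI)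
    show "state_on ?A ?\<tau>" by (rule state_on_cong[OF _ state_on_vector_trace]) simp
    show "?\<tau> \<in> extensional ?A" by simp
    show "tracial_on ?A ?\<tau>"
      using tracial_on_vector_trace by (simp add: tracial_on_def reduced_cstar_compose)
    fix W :: "'i free_group set" and a
    assume "finite W"
    have "(\<Sum>w\<in>W. a w *\<^sub>O lreg w) \<in> ?A"
      by (intro subspace_sum[OF subspace_reduced_cstar] reduced_cstar_scaleC lreg_reduced_cstar)
    moreover have "vector_trace (\<Sum>w\<in>W. a w *\<^sub>O lreg w) = (\<Sum>w\<in>W. if w = 1 then a w else 0)"
      by (simp add: linear_sum[OF bounded_linear.linear[OF bounded_linear_vector_trace]]
          vector_trace_scaleC vector_trace_lreg if_distrib cong: if_cong)
    ultimately show "?\<tau> (\<Sum>w\<in>W. a w *\<^sub>O lreg w) = (if 1 \<in> W then a 1 else 0)"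
      using \<open>finite W\<close> by simp
  next
    fix \<tau> :: "'i free_group operator \<Rightarrow> complex"
    assume \<tau>: "\<tau> \<in> extensional ?A \<and> state_on ?A \<tau> \<and> tracial_on ?A \<tau> \<and>
      (\<forall>W a. finite W \<longrightarrow> \<tau> (\<Sum>w\<in>W. a w *\<^sub>O lreg w) = (if 1 \<in> W then a 1 else 0))"
    have "\<tau> (lreg w) = vector_trace (lreg w)" for w
    proof -
      have "\<tau> (\<Sum>w\<in>{w}. 1 *\<^sub>O lreg w) = (if 1 \<in> {w} then 1 else 0)"
        using \<tau> by (elim conjE) (erule allE[of _ "{w}"], erule allE[of _ "\<lambda>_. 1"], simp)
      then show ?thesis
        using op_scaleC_of_real[of 1 "lreg w"] by (auto simp: vector_trace_lreg)
    qed
    then show "\<tau> = ?\<tau>"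
      using \<tau> state_eqI[OF _ state_on_vector_trace]
      by (intro extensionalityI[of _ ?A]) auto
  qed
  show ?thesis unfolding eq using assms by simp
qed


section \<open>The action of permutations of the generators\<close>

definition rename_letter :: "('i \<Rightarrow> 'j) \<Rightarrow> 'i letter \<Rightarrow> 'j letter"
  where "rename_letter f x = (f (fst x), snd x)"

lemma rename_letter_eq_inv_iff:
  "inj f \<Longrightarrow> rename_letter f y = inv_letter (rename_letter f x) \<longleftrightarrow> y = inv_letter x"
  by (auto simp: rename_letter_def inv_letter_def inj_eq prod_eq_iff)

lemma push_map:
  "inj f \<Longrightarrow> push (rename_letter f x) (map (rename_letter f) ys) = map (rename_letter f) (push x ys)"
  by (cases ys) (auto simp: rename_letter_eq_inv_iff)

lemma rmult_map:
  "inj f \<Longrightarrow>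
    rmult (map (rename_letter f) u) (map (rename_letter f) v) = map (rename_letter f) (rmult u v)"
  by (induction u) (simp_all add: rmult_def push_map)

lemma reduced_map: "inj f \<Longrightarrow> reduced w \<Longrightarrow> reduced (map (rename_letter f) w)"
  by (induction w rule: reduced.induct) (auto simp: rename_letter_eq_inv_iff)

lift_definition rename :: "'i perm \<Rightarrow> 'i free_group \<Rightarrow> 'i free_group"
  is "\<lambda>\<sigma>. map (rename_letter (Perm.apply \<sigma>))"
  by (rule reduced_map) (simp_all add: bij_is_inj)

lemma rename_mult: "rename \<sigma> (u * v) = rename \<sigma> u * rename \<sigma> v"
  by transfer (simp add: rmult_map bij_is_inj)

lemma rename_one: "rename \<sigma> 1 = 1"
  by transfer simp

lemma rename_free_gen: "rename \<sigma> (free_gen i) = free_gen (Perm.apply \<sigma> i)"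
  by transfer (simp add: rename_letter_def)

lemma rename_rename_inverse:
  "rename \<sigma> (rename (inverse \<sigma>) w) = w" "rename (inverse \<sigma>) (rename \<sigma> w) = w"
proof -
  have "bij (Perm.apply \<sigma>)" by simp
  then have "Perm.apply \<sigma> (Perm.apply (inverse \<sigma>) i) = i"
    "Perm.apply (inverse \<sigma>) (Perm.apply \<sigma> i) = i" for i
    by (simp_all add: inverse_perm.rep_eq bij_is_surj bij_is_inj surj_f_inv_f inv_f_f)
  then show "rename \<sigma> (rename (inverse \<sigma>) w) = w" "rename (inverse \<sigma>) (rename \<sigma> w) = w"
    by (simp_all add: letters_inject[symmetric] rename.rep_eq rename_letter_def comp_def map_idI)
qed

lemma bij_rename: "bij (rename \<sigma>)"
  by (rule bij_betw_byWitness[where f' = "rename (inverse \<sigma>)"]) (auto simp: rename_rename_inverse)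

text \<open>The unitary of \<open>\<ell>\<^sup>2\<close> of the free group that maps \<open>\<delta>\<^sub>v\<close> to \<open>\<delta>\<^bsub>\<sigma>(v)\<^esub>\<close>. Conjugation by it
  realises the automorphism permuting the generators.\<close>

definition relabel :: "'i perm \<Rightarrow> 'i free_group ell2 \<Rightarrow> 'i free_group ell2"
  where "relabel \<sigma> f = Ell2 (\<lambda>v. ell2_apply f (rename (inverse \<sigma>) v))"

lemma ell2_apply_relabel: "ell2_apply (relabel \<sigma> f) v = ell2_apply f (rename (inverse \<sigma>) v)"
proof -
  have "(\<lambda>v. (cmod (ell2_apply f (rename (inverse \<sigma>) v)))\<^sup>2) summable_on UNIV"
    using ell2_square_summable by (rule summable_on_reindex_bij_betw[OF bij_rename, THEN iffD2])
  then have "ell2_apply (relabel \<sigma> f) = (\<lambda>v. ell2_apply f (rename (inverse \<sigma>) v))"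
    unfolding relabel_def by (intro Ell2_inverse) blast
  then show ?thesis by (rule fun_cong)
qed

lemma cinner_relabel: "cinner (relabel \<sigma> f) g = cinner f (relabel (inverse \<sigma>) g)"
proof -
  have "cinner (relabel \<sigma> f) g =
      (\<Sum>\<^sub>\<infinity>v. (\<lambda>u. ell2_apply f u * cnj (ell2_apply g (rename \<sigma> u))) (rename (inverse \<sigma>) v))"
    by (simp add: cinner.rep_eq ell2_apply_relabel rename_rename_inverse)
  also have "\<dots> = (\<Sum>\<^sub>\<infinity>u. ell2_apply f u * cnj (ell2_apply g (rename \<sigma> u)))"
    by (rule infsum_reindex_bij_betw[OF bij_rename])
  also have "\<dots> = cinner f (relabel (inverse \<sigma>) g)"
    by (simp add: cinner.rep_eq ell2_apply_relabel)
  finally show ?thesis .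
qed

lemma relabel_relabel_inverse:
  "relabel \<sigma> (relabel (inverse \<sigma>) f) = f" "relabel (inverse \<sigma>) (relabel \<sigma> f) = f"
  by (rule ell2_eqI, simp add: ell2_apply_relabel rename_rename_inverse)+

lemma norm_relabel: "norm (relabel \<sigma> f) = norm f"
proof -
  have "complex_of_real ((norm (relabel \<sigma> f))\<^sup>2) = of_real ((norm f)\<^sup>2)"
    unfolding cinner_self[symmetric] by (simp add: cinner_relabel relabel_relabel_inverse)
  then show ?thesis by (simp only: of_real_eq_iff) simp
qed

lemma bounded_linear_relabel: "bounded_linear (relabel \<sigma>)"
  by (rule bounded_linear_intro[where K = 1])
     (auto intro!: ell2_eqI simp: ell2_apply_relabel plus_ell2.rep_eq scaleR_ell2.rep_eq norm_relabel)

definition relabel_op :: "'i perm \<Rightarrow> 'i free_group operator"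
  where "relabel_op \<sigma> = Blinfun (relabel \<sigma>)"

lemma blinfun_apply_relabel_op: "blinfun_apply (relabel_op \<sigma>) = relabel \<sigma>"
  unfolding relabel_op_def by (rule bounded_linear_Blinfun_apply[OF bounded_linear_relabel])

definition conjugate :: "'i perm \<Rightarrow> 'i free_group operator \<Rightarrow> 'i free_group operator"
  where "conjugate \<sigma> T = relabel_op \<sigma> o\<^sub>L T o\<^sub>L relabel_op (inverse \<sigma>)"

lemma conjugate_apply:
  "blinfun_apply (conjugate \<sigma> T) f = relabel \<sigma> (blinfun_apply T (relabel (inverse \<sigma>) f))"
  by (simp add: conjugate_def blinfun_apply_relabel_op)

lemma relabel_scaleC: "relabel \<sigma> (c *\<^sub>C f) = c *\<^sub>C relabel \<sigma> f"
  by (rule ell2_eqI) (simp add: ell2_apply_relabel scaleC.rep_eq)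

lemma bounded_linear_conjugate: "bounded_linear (conjugate \<sigma>)"
  unfolding conjugate_def
  by (intro bounded_linear_compose[OF
        bounded_bilinear.bounded_linear_left[OF bounded_bilinear_blinfun_compose]]
      bounded_bilinear.bounded_linear_right[OF bounded_bilinear_blinfun_compose])

lemma conjugate_compose: "conjugate \<sigma> (S o\<^sub>L T) = conjugate \<sigma> S o\<^sub>L conjugate \<sigma> T"
  by (rule blinfun_eqI) (simp add: conjugate_apply relabel_relabel_inverse)

lemma conjugate_scaleC: "conjugate \<sigma> (c *\<^sub>O T) = c *\<^sub>O conjugate \<sigma> T"
  by (rule blinfun_eqI) (simp add: conjugate_apply blinfun_apply_op_scaleC relabel_scaleC)

lemma conjugate_conjugate_inverse:
  "conjugate \<sigma> (conjugate (inverse \<sigma>) T) = T" "conjugate (inverse \<sigma>) (conjugate \<sigma> T) = T"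
  by (rule blinfun_eqI, simp add: conjugate_apply relabel_relabel_inverse)+

lemma conjugate_adjoint_pair: "adjoint_pair T S \<Longrightarrow> adjoint_pair (conjugate \<sigma> T) (conjugate \<sigma> S)"
  using cinner_relabel[of "inverse \<sigma>"]
  by (simp add: adjoint_pair_def conjugate_apply cinner_relabel)

lemma rename_inverse_word: "rename \<sigma> (inverse w) = inverse (rename \<sigma> w)"
  by (metis free_group_left_inverse free_group_right_inverse mult.assoc mult_1 mult.right_neutral
      rename_mult rename_one)

lemma conjugate_lreg: "conjugate \<sigma> (lreg w) = lreg (rename \<sigma> w)"
proof (intro blinfun_eqI ell2_eqI)
  fix f v
  have "rename \<sigma> (inverse w * rename (inverse \<sigma>) v) = inverse (rename \<sigma> w) * v"
    by (simp add: rename_mult rename_inverse_word rename_rename_inverse)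
  then show "ell2_apply (blinfun_apply (conjugate \<sigma> (lreg w)) f) v
      = ell2_apply (blinfun_apply (lreg (rename \<sigma> w)) f) v"
    by (simp add: conjugate_apply blinfun_apply_lreg ell2_apply_relabel ell2_apply_translate)
qed

lemma conjugate_reduced_cstar:
  assumes "T \<in> reduced_cstar"
  shows "conjugate \<sigma> T \<in> reduced_cstar"
proof -
  have "reduced_cstar \<subseteq> conjugate \<sigma> -` reduced_cstar"
    by (intro reduced_cstar_subsetI closed_subspace_vimage[OF bounded_linear_conjugate]
        closed_reduced_cstar subspace_reduced_cstar)
       (simp add: conjugate_scaleC conjugate_lreg reduced_cstar_scaleC lreg_reduced_cstar)
  with assms show ?thesis by blast
qed

lemma cstar_automorphism_conjugate:
  "cstar_automorphism reduced_cstar (restrict (conjugate \<sigma>) reduced_cstar)"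
proof -
  have "bij_betw (conjugate \<sigma>) reduced_cstar reduced_cstar"
    by (rule bij_betw_byWitness[where f' = "conjugate (inverse \<sigma>)"])
       (auto simp: conjugate_conjugate_inverse conjugate_reduced_cstar)
  then show ?thesis
    unfolding cstar_automorphism_def
    using op_adj_eqI[OF conjugate_adjoint_pair[OF adjoint_pair_op_adj], symmetric]
    by (auto simp: subspace_add[OF subspace_reduced_cstar] reduced_cstar_compose reduced_cstar_scaleC
        reduced_cstar_adj conjugate_compose conjugate_scaleC
        linear_add[OF bounded_linear.linear[OF bounded_linear_conjugate]] cong: bij_betw_cong)
qed

lemma perm_action_eq:
  fixes T :: "'i free_group operator"
  assumes "T \<in> reduced_cstar"
  shows "perm_action \<sigma> T = conjugate \<sigma> T"
proof -
  let ?A = "reduced_cstar :: 'i free_group operator set"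
  have "perm_action \<sigma> = restrict (conjugate \<sigma>) ?A"
    unfolding perm_action_def
  proof (rule the_equality)
    show gen: "restrict (conjugate \<sigma>) ?A \<in> extensional ?A \<and>
      cstar_automorphism ?A (restrict (conjugate \<sigma>) ?A) \<and>
      (\<forall>i. restrict (conjugate \<sigma>) ?A (lreg (free_gen i)) = lreg (free_gen (Perm.apply \<sigma> i)))"
      by (simp add: cstar_automorphism_conjugate lreg_reduced_cstar conjugate_lreg rename_free_gen)
    fix \<alpha>
    assume \<alpha>: "\<alpha> \<in> extensional ?A \<and> cstar_automorphism ?A \<alpha> \<and>
      (\<forall>i. \<alpha> (lreg (free_gen i)) = lreg (free_gen (Perm.apply \<sigma> i)))"
    then have "cstar_automorphism ?A \<alpha>"
      and "\<And>i. \<alpha> (lreg (free_gen i)) = lreg (free_gen (Perm.apply \<sigma> i))" by blast+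
    then have "\<alpha> T = restrict (conjugate \<sigma>) ?A T" if "T \<in> ?A" for T
      using gen by (intro automorphism_eqI[OF _ cstar_automorphism_conjugate _ that]) simp_all
    moreover have "\<alpha> \<in> extensional ?A" using \<alpha> by blast
    ultimately show "\<alpha> = restrict (conjugate \<sigma>) ?A"
      by (intro extensionalityI[of _ ?A]) auto
  qed
  with assms show ?thesis by simp
qed

text \<open>The unitary implementing the permutation fixes \<open>\<delta>\<^sub>1\<close>, and therefore its vector state is
  invariant under conjugation.\<close>

lemma symmetric_state_canonical_trace: "symmetric_state canonical_trace"
  unfolding symmetric_state_def
proof (intro conjI allI ballI)
  show "state_on reduced_cstar canonical_trace"
    by (rule state_on_cong[OF canonical_trace_eq state_on_vector_trace])
  fix \<sigma> and T :: "'a free_group operator"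
  assume T: "T \<in> reduced_cstar"
  have "rename \<sigma> x = 1 \<longleftrightarrow> x = 1" for x :: "'a free_group"
    by (metis rename_one rename_rename_inverse)
  then have "relabel (inverse \<sigma>) (delta 1) = delta (1 :: 'a free_group)"
    by (intro ell2_eqI) (simp add: ell2_apply_relabel delta.rep_eq)
  then have "vector_trace (conjugate \<sigma> T) = vector_trace T"
    by (simp add: vector_trace_def conjugate_apply ell2_apply_relabel rename_one)
  with T show "canonical_trace (perm_action \<sigma> T) = canonical_trace T"
    by (simp add: perm_action_eq conjugate_reduced_cstar canonical_trace_eq)
qed


section \<open>A norm estimate for words in disjoint alphabets\<close>

lift_definition cut_off :: "'a set \<Rightarrow> 'a ell2 \<Rightarrow> 'a ell2" is "\<lambda>E f x. if x \<in> E then f x else 0"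
  by (rule summable_on_comparison_test) auto

lemma norm_cut_off_le: "norm (cut_off E f) \<le> norm f"
proof (rule norm_ell2_le)
  fix F :: "'a set" assume "finite F"
  have "(\<Sum>x\<in>F. (cmod (ell2_apply (cut_off E f) x))\<^sup>2) \<le> (\<Sum>x\<in>F. (cmod (ell2_apply f x))\<^sup>2)"
    by (rule sum_mono) (simp add: cut_off.rep_eq)
  also have "\<dots> \<le> (norm f)\<^sup>2" by (rule sum_squares_le_norm[OF \<open>finite F\<close>])
  finally show "(\<Sum>x\<in>F. (cmod (ell2_apply (cut_off E f) x))\<^sup>2) \<le> (norm f)\<^sup>2" .
qed simp

lemma norm_sum_disjoint_support:
  assumes "finite J"
    and "\<And>i j x. i \<in> J \<Longrightarrow> j \<in> J \<Longrightarrow> i \<noteq> j \<Longrightarrow> ell2_apply (h i) x = 0 \<or> ell2_apply (h j) x = 0"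
  shows "(norm (\<Sum>j\<in>J. h j))\<^sup>2 = (\<Sum>j\<in>J. (norm (h j))\<^sup>2)"
proof (rule norm_sum_Pythagorean[OF assms(1)])
  have "(\<Sum>\<^sub>\<infinity>x. ell2_apply (h i) x \<bullet> ell2_apply (h j) x) = 0" if "i \<in> J" "j \<in> J" "i \<noteq> j" for i j
    using assms(2)[OF that] by (intro infsum_0) (metis inner_zero_left inner_zero_right)
  then show "pairwise (\<lambda>i j. orthogonal (h i) (h j)) J"
    by (simp add: pairwise_def orthogonal_def inner_ell2.rep_eq)
qed

lemma ell2_apply_sum: "ell2_apply (\<Sum>j\<in>J. h j) x = (\<Sum>j\<in>J. ell2_apply (h j) x)"
  by (induction J rule: infinite_finite_induct) (simp_all add: zero_ell2.rep_eq plus_ell2.rep_eq)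

text \<open>Bessel's inequality for the projections onto functions supported in disjoint sets.\<close>

lemma sum_norm_cut_off_le:
  assumes "finite J" and disj: "\<And>i j. i \<in> J \<Longrightarrow> j \<in> J \<Longrightarrow> i \<noteq> j \<Longrightarrow> E i \<inter> E j = {}"
  shows "(\<Sum>j\<in>J. (norm (cut_off (E j) f))\<^sup>2) \<le> (norm f)\<^sup>2"
proof -
  have "(\<Sum>j\<in>J. cut_off (E j) f) = cut_off (\<Union>j\<in>J. E j) f"
  proof (rule ell2_eqI)
    fix x
    show "ell2_apply (\<Sum>j\<in>J. cut_off (E j) f) x = ell2_apply (cut_off (\<Union>j\<in>J. E j) f) x"
    proof (cases "\<exists>k\<in>J. x \<in> E k")
      case True
      then obtain k where k: "k \<in> J" "x \<in> E k" by blast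
      have "(\<Sum>j\<in>J. ell2_apply (cut_off (E j) f) x) = (\<Sum>j\<in>J. if j = k then ell2_apply f x else 0)"
        using disj k by (intro sum.cong) (auto simp: cut_off.rep_eq)
      with k \<open>finite J\<close> show ?thesis by (auto simp: ell2_apply_sum cut_off.rep_eq)
    qed (simp add: ell2_apply_sum cut_off.rep_eq)
  qed
  moreover have "(norm (\<Sum>j\<in>J. cut_off (E j) f))\<^sup>2 = (\<Sum>j\<in>J. (norm (cut_off (E j) f))\<^sup>2)"
    by (rule norm_sum_disjoint_support[OF assms(1)]) (use disj in \<open>auto simp: cut_off.rep_eq\<close>)
  ultimately show ?thesis
    using norm_cut_off_le[of "\<Union>j\<in>J. E j" f] by (metis norm_ge_zero power_mono)
qed

definition alphabet :: "'i free_group \<Rightarrow> 'i set"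
  where "alphabet w = fst ` set (letters w)"

definition starts_in :: "'i set \<Rightarrow> 'i free_group set"
  where "starts_in I = {v. letters v \<noteq> [] \<and> fst (hd (letters v)) \<in> I}"

lemma rmult_eq_append:
  assumes "reduced u" "\<And>x. x \<in> set u \<Longrightarrow> v = [] \<or> fst (hd v) \<noteq> fst x"
  shows "rmult u v = u @ v"
  using assms
proof (induction u)
  case (Cons x u)
  then have IH: "foldr push u v = u @ v"
    using reduced_ConsD[of x u] by (simp add: rmult_def)
  have "push x (u @ v) = x # u @ v"
  proof (cases u)
    case Nil
    then show ?thesis using Cons.prems(2)[of x] by (cases v) (auto simp: inv_letter_def)
  next
    case (Cons y ys)
    then show ?thesis using \<open>reduced (x # u)\<close> by simp
  qed
  with IH show ?case by (simp add: rmult_def)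
qed (simp add: rmult_def)

text \<open>The ping-pong step: no cancellation can occur between \<open>w\<close> and a word that is empty or starts with
  a letter foreign to the alphabet of \<open>w\<close>, so the product keeps the first letter of \<open>w\<close>.\<close>

lemma mult_in_starts_in:
  assumes "w \<noteq> 1" "v \<notin> starts_in (alphabet w)"
  shows "w * v \<in> starts_in (alphabet w)"
proof -
  have "letters w \<noteq> []"
    using assms(1) by (metis letters_inject one_free_group.rep_eq)
  moreover have "letters (w * v) = letters w @ letters v"
    unfolding times_free_group.rep_eq
    using assms(2) letters[of w] by (intro rmult_eq_append) (auto simp: starts_in_def alphabet_def)
  ultimately show ?thesis by (simp add: starts_in_def alphabet_def)
qed

text \<open>Each \<open>f\<close> is split, for every \<open>j\<close>, into its part \<open>g j\<close> on the words starting in the \<open>j\<close>-th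
  alphabet and the rest. The translated rests \<open>h j\<close> have disjoint supports by the ping-pong step,
  so their squared norms add up to at most \<open>N \<parallel>f\<parallel>\<^sup>2\<close>. The \<open>g j\<close> are orthogonal before translation,
  so \<open>\<Sum>\<parallel>g j\<parallel> \<le> \<surd>N \<parallel>f\<parallel>\<close>.\<close>

lemma norm_sum_lreg_le:
  fixes w :: "'j \<Rightarrow> 'i free_group"
  assumes "finite J" "\<And>j. j \<in> J \<Longrightarrow> w j \<noteq> 1"
    and disj: "\<And>i j. i \<in> J \<Longrightarrow> j \<in> J \<Longrightarrow> i \<noteq> j \<Longrightarrow> alphabet (w i) \<inter> alphabet (w j) = {}"
  shows "norm (\<Sum>j\<in>J. lreg (w j)) \<le> 2 * sqrt (card J)"
proof (rule norm_blinfun_bound)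
  fix f
  define E where "E j = starts_in (alphabet (w j))" for j
  define g where "g j = cut_off (E j) f" for j
  define h where "h j = translate (w j) (f - g j)" for j
  have E: "E i \<inter> E j = {}" if "i \<in> J" "j \<in> J" "i \<noteq> j" for i j
    using disj[OF that] by (auto simp: E_def starts_in_def)
  have "(norm (\<Sum>j\<in>J. h j))\<^sup>2 = (\<Sum>j\<in>J. (norm (h j))\<^sup>2)"
  proof (rule norm_sum_disjoint_support[OF assms(1)])
    have supp: "ell2_apply (h j) x = 0" if "j \<in> J" "x \<notin> E j" for j x
    proof -
      have "inverse (w j) * x \<in> E j"
      proof (rule ccontr)
        assume "inverse (w j) * x \<notin> E j"
        then have "w j * (inverse (w j) * x) \<in> E j"
          unfolding E_def by (intro mult_in_starts_in assms(2) that(1))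
        with that(2) show False by (simp add: free_group_right_inverse flip: mult.assoc)
      qed
      then show ?thesis
        by (simp add: h_def g_def ell2_apply_translate minus_ell2.rep_eq cut_off.rep_eq)
    qed
    show "ell2_apply (h i) x = 0 \<or> ell2_apply (h j) x = 0" if "i \<in> J" "j \<in> J" "i \<noteq> j" for i j x
      using E[OF that] supp that by blast
  qed
  also have "\<dots> \<le> (\<Sum>j\<in>J. (norm f)\<^sup>2)"
  proof (rule sum_mono)
    fix j
    have "f - g j = cut_off (- E j) f"
      by (rule ell2_eqI) (simp add: g_def minus_ell2.rep_eq cut_off.rep_eq)
    then show "(norm (h j))\<^sup>2 \<le> (norm f)\<^sup>2"
      using norm_cut_off_le[of "- E j" f] by (simp add: h_def norm_translate)
  qed
  also have "\<dots> = (sqrt (card J) * norm f)\<^sup>2" by (simp add: power_mult_distrib)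
  finally have h: "norm (\<Sum>j\<in>J. h j) \<le> sqrt (card J) * norm f"
    by (rule power2_le_imp_le) simp
  have "(norm (\<Sum>j\<in>J. translate (w j) (g j)))\<^sup>2 \<le> (\<Sum>j\<in>J. norm (g j))\<^sup>2"
    by (intro power_mono order_trans[OF norm_sum]) (simp_all add: norm_translate)
  also have "\<dots> = (\<Sum>j\<in>J. 1 * norm (g j))\<^sup>2" by simp
  also have "\<dots> \<le> (\<Sum>j\<in>J. 1\<^sup>2) * (\<Sum>j\<in>J. (norm (g j))\<^sup>2)"
    by (rule Cauchy_Schwarz_ineq_sum)
  also have "\<dots> \<le> card J * (norm f)\<^sup>2"
    using sum_norm_cut_off_le[OF assms(1) E] by (simp add: g_def mult_left_mono)
  also have "\<dots> = (sqrt (card J) * norm f)\<^sup>2" by (simp add: power_mult_distrib)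
  finally have g: "norm (\<Sum>j\<in>J. translate (w j) (g j)) \<le> sqrt (card J) * norm f"
    by (rule power2_le_imp_le) simp
  have "translate (w j) f = translate (w j) (g j) + h j" for j
    by (rule ell2_eqI) (simp add: h_def ell2_apply_translate plus_ell2.rep_eq minus_ell2.rep_eq)
  then have "blinfun_apply (\<Sum>j\<in>J. lreg (w j)) f = (\<Sum>j\<in>J. translate (w j) (g j)) + (\<Sum>j\<in>J. h j)"
    by (simp add: blinfun.sum_left blinfun_apply_lreg sum.distrib)
  then show "norm (blinfun_apply (\<Sum>j\<in>J. lreg (w j)) f) \<le> 2 * sqrt (card J) * norm f"
    using norm_triangle_le[OF add_mono[OF g h]] by (simp add: mult_ac)
qed simp


section \<open>Uniqueness of the symmetric state\<close>

text \<open>The \<open>j\<close>-th permutation exchanges the interval \<open>[-M, M]\<close>, which contains \<open>I\<close>, with its translate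
  by \<open>L j\<close>. The shifts are distinct positive multiples of \<open>2 * M + 1\<close>, the number of points of the
  interval, so that all translates are disjoint from each other and from the interval.\<close>

lemma exists_disjoint_permutations:
  fixes I :: "int set"
  assumes "finite I"
  shows "\<exists>\<sigma> :: nat \<Rightarrow> int perm. \<forall>j k. j \<noteq> k \<longrightarrow> Perm.apply (\<sigma> j) ` I \<inter> Perm.apply (\<sigma> k) ` I = {}"
proof -
  obtain M where M: "\<And>x. x \<in> I \<Longrightarrow> \<bar>x\<bar> \<le> M" "0 \<le> M"
  proof
    show "\<bar>x\<bar> \<le> (\<Sum>y\<in>I. \<bar>y\<bar>)" if "x \<in> I" for x
      using assms that by (intro member_le_sum) auto
  qed (simp add: sum_nonneg)
  define L where "L j = (2 * M + 1) * (int j + 1)" for j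
  define s where "s j x = (if \<bar>x\<bar> \<le> M then x + L j else if \<bar>x - L j\<bar> \<le> M then x - L j else x)" for j x
  have L: "2 * M + 1 \<le> L j" for j
    using mult_left_mono[of 1 "int j + 1" "2 * M + 1"] M(2) by (simp add: L_def)
  have inv: "s j (s j x) = x" for j x
    using L[of j] by (auto simp: s_def)
  have "bij (s j) \<and> finite {x. s j x \<noteq> x}" for j
  proof
    show "bij (s j)" by (rule bij_betw_byWitness[where f' = "s j"]) (auto simp: inv)
    have "{x. s j x \<noteq> x} \<subseteq> {-M..M} \<union> {L j - M..L j + M}" by (auto simp: s_def split: if_splits)
    then show "finite {x. s j x \<noteq> x}" by (rule finite_subset) simp
  qed
  then have s: "Perm.apply (Perm.Perm (s j)) = s j" for j by (simp add: Perm.Perm_inverse)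
  have "s j ` I \<inter> s k ` I = {}" if "j \<noteq> k" for j k
  proof (rule ccontr)
    assume "s j ` I \<inter> s k ` I \<noteq> {}"
    then obtain x y where "x \<in> I" "y \<in> I" "s j x = s k y" by blast
    with M(1)[of x] M(1)[of y] have "x + L j = y + L k" "\<bar>y - x\<bar> \<le> 2 * M" by (auto simp: s_def)
    then have "\<bar>(2 * M + 1) * (int j - int k)\<bar> \<le> 2 * M" by (simp add: L_def algebra_simps)
    then have "(2 * M + 1) * \<bar>int j - int k\<bar> \<le> 2 * M" using M(2) by (simp add: abs_mult)
    moreover have "(2 * M + 1) * 1 \<le> (2 * M + 1) * \<bar>int j - int k\<bar>"
      using M(2) that by (intro mult_left_mono) auto
    ultimately have "(2 * M + 1) * 1 \<le> 2 * M" by (rule order_trans[rotated])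
    then show False by simp
  qed
  then show ?thesis by (intro exI[of _ "\<lambda>j. Perm.Perm (s j)"]) (simp add: s)
qed

lemma alphabet_rename: "alphabet (rename \<sigma> w) = Perm.apply \<sigma> ` alphabet w"
  by (force simp: alphabet_def rename.rep_eq rename_letter_def)

text \<open>With \<open>a = \<bar>\<phi>(\<lambda>\<^sub>w)\<bar>\<close>, symmetry and the norm estimate give \<open>N a \<le> 2 \<cdot> 2\<surd>N\<close> for all \<open>N\<close>, where one
  factor 2 is the bound for states; that is \<open>N a\<^sup>2 \<le> 16\<close>.\<close>

lemma symmetric_state_lreg:
  fixes \<phi> :: "int free_group operator \<Rightarrow> complex"
  assumes "symmetric_state \<phi>" "w \<noteq> 1"
  shows "\<phi> (lreg w) = 0"
proof (rule ccontr)
  assume "\<phi> (lreg w) \<noteq> 0"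
  define a where "a = cmod (\<phi> (lreg w))"
  have a: "0 < a" using \<open>\<phi> (lreg w) \<noteq> 0\<close> by (simp add: a_def)
  have \<phi>: "state_on reduced_cstar \<phi>" using assms(1) by (simp add: symmetric_state_def)
  have inv: "\<phi> (lreg (rename \<sigma> w)) = \<phi> (lreg w)" for \<sigma>
    using assms(1) lreg_reduced_cstar[of w]
    by (metis symmetric_state_def perm_action_eq conjugate_lreg)
  have "finite (alphabet w)" by (simp add: alphabet_def)
  then obtain \<sigma> :: "nat \<Rightarrow> int perm" where \<sigma>:
    "\<And>j k. j \<noteq> k \<Longrightarrow> Perm.apply (\<sigma> j) ` alphabet w \<inter> Perm.apply (\<sigma> k) ` alphabet w = {}"
    using exists_disjoint_permutations by blast
  obtain N :: nat where N: "16 / a\<^sup>2 < N" using reals_Archimedean2 by blast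
  define T where "T = (\<Sum>j<N. lreg (rename (\<sigma> j) w))"
  have sum: "\<phi> (\<Sum>j<n. lreg (rename (\<sigma> j) w)) = of_nat n * \<phi> (lreg w)
      \<and> (\<Sum>j<n. lreg (rename (\<sigma> j) w)) \<in> reduced_cstar" for n
  proof (induction n)
    case 0
    show ?case using state_scaleR[OF \<phi> subspace_0[OF subspace_reduced_cstar], of 0]
      by (simp add: subspace_0[OF subspace_reduced_cstar])
  next
    case (Suc n)
    then show ?case
      by (simp add: state_add[OF \<phi>] lreg_reduced_cstar inv subspace_add[OF subspace_reduced_cstar]
          algebra_simps)
  qed
  have "rename (\<sigma> j) w \<noteq> 1" for j
    using assms(2) by (metis rename_one rename_rename_inverse(2))
  then have "norm T \<le> 2 * sqrt N"
    using norm_sum_lreg_le[of "{..<N}" "\<lambda>j. rename (\<sigma> j) w"] \<sigma> by (simp add: T_def alphabet_rename)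
  moreover have "real N * a \<le> 2 * norm T"
    using state_norm_le[OF \<phi>, of T] sum[of N] by (simp add: T_def a_def norm_mult)
  ultimately have "real N * a \<le> 4 * sqrt N" by linarith
  then have "(real N * a)\<^sup>2 \<le> (4 * sqrt N)\<^sup>2" using a by (intro power_mono) auto
  then have "real N * (real N * a\<^sup>2) \<le> real N * 16"
    unfolding power_mult_distrib real_sqrt_pow2[OF of_nat_0_le_iff]
    by (simp add: power2_eq_square mult_ac)
  moreover have "0 < real N" using N a by (meson divide_nonneg_pos less_le_trans less_imp_le not_le
        order_le_less_trans zero_less_power zero_le_numeral)
  ultimately have "real N * a\<^sup>2 \<le> 16" by simp
  moreover have "16 < real N * a\<^sup>2" using N a by (simp add: divide_simps)
  ultimately show False by linarith
qed

theorem corollary6p3: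
  shows "symmetric_state (canonical_trace :: int free_group operator \<Rightarrow> complex) \<and>
    (\<forall>\<phi> :: int free_group operator \<Rightarrow> complex. symmetric_state \<phi> \<longrightarrow>
       (\<forall>T\<in>reduced_cstar. \<phi> T = canonical_trace T))"
proof (intro conjI allI impI ballI)
  fix \<phi> :: "int free_group operator \<Rightarrow> complex" and T :: "int free_group operator"
  assume sym: "symmetric_state \<phi>" and T: "T \<in> reduced_cstar"
  then have \<phi>: "state_on reduced_cstar \<phi>" by (simp add: symmetric_state_def)
  have "\<phi> T = vector_trace T"
  proof (rule state_eqI[OF \<phi> state_on_vector_trace _ T])
    show "\<phi> (lreg w) = vector_trace (lreg w)" for w
      using symmetric_state_lreg[OF sym] state_id[OF \<phi>, folded lreg_one]
      by (cases "w = 1") (simp_all add: vector_trace_lreg lreg_one[symmetric])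
  qed
  with T show "\<phi> T = canonical_trace T" by (simp add: canonical_trace_eq)
qed (rule symmetric_state_canonical_trace)

end
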